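(* Let $G=(V,E)$ be a connected, symmetric, locally finite weighted graph such that $\mu(x)\ge\mu_0>0$ for all $x\in V$ and $\sum_{y\sim x}\omega_{xy}<C$ for all $x\in V$, where $\mu_0,C$ are positive constants. Let $0<\gamma<1<q\le p<\alpha+1$; let $f,g:V\to\mathbb{R}$ with $f>0$, $g\ge 0$, $g\not\equiv 0$, $f\in L^1(V)\cap L^{\frac{p}{p-1+\gamma}}(V)\cap L^{\frac{q}{q-1+\gamma}}(V)$, $g\in L^1(V)\cap L^\infty(V)$; and let $a,b:V\to(0,\infty)$ satisfy $a(x)\ge a_0>0$ and $b(x)\ge b_0>0$ for all $x\in V$, for some constants $a_0,b_0$. Assume $\lambda<0$. Then the equation $$-\Delta_p u-\Delta_q u+a(x)u^{p-1}+b(x)u^{q-1}=f(x)u^{-\gamma}+\lambda g(x)u^{\alpha}\ \text{ in } V,\qquad u>0,\ u\in W:=W_a^{1,p}(V)\cap W_b^{1,q}(V),$$ has one and only one positive solution.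
   Context: Graph setting. $V$ is the vertex set and $E$ the edge set; $y\sim x$ means $xy\in E$. Locally finite: each vertex has finitely many neighbours. Symmetric: edge weights satisfy $\omega_{xy}=\omega_{yx}>0$ for $xy\in E$. Vertex measure $\mu:V\to(0,\infty)$. $\int_V\psi\,d\mu=\sum_{x\in V}\mu(x)\psi(x)$. $\|u\|_\theta=(\int_V|u|^\theta d\mu)^{1/\theta}$ for $1\le\theta<\infty$, $\|u\|_\infty=\sup_V|u|$, and $L^\theta(V)$ is the set of functions $V\to\mathbb{R}$ with finite norm. Gradient and Laplacian. $\Gamma(u,v)(x)=\frac{1}{2\mu(x)}\sum_{y\sim x}\omega_{xy}(u(y)-u(x))(v(y)-v(x))$, $|\nabla u|(x)=\sqrt{\Gamma(u,u)(x)}$. For $s>1$, $$\Delta_s u(x)=\frac{1}{2\mu(x)}\sum_{y\sim x}\left(|\nabla u|^{s-2}(y)+|\nabla u|^{s-2}(x)\right)\omega_{xy}(u(y)-u(x)),$$ and, for $s<2$, terms $|\nabla u|^{s-2}(z)\,(u(y)-u(x))$ with $z\in\{x,y\}$, and $|\nabla u|^{s-2}\Gamma(u,\phi)$, are read as $0$ where $|\nabla u|=0$. Spaces. $W^{1,s}(V)=\{u:V\to\mathbb{R}:\int_V(|\nabla u|^s+|u|^s)d\mu<\infty\}$; $W_a^{1,p}(V)=\{u\in W^{1,p}(V):\int_V a|u|^pd\mu<\infty\}$; $W_b^{1,q}(V)=\{u\in W^{1,q}(V):\int_V b|u|^qd\mu<\infty\}$. Solutions. A positive solution is a weak solution: $u\in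 W$ with $u>0$ on $V$ and, for every $\phi\in W$, $$\int_V(|\nabla u|^{p-2}\Gamma(u,\phi)+a u^{p-1}\phi)d\mu+\int_V(|\nabla u|^{q-2}\Gamma(u,\phi)+b u^{q-1}\phi)d\mu=\int_V f u^{-\gamma}\phi\,d\mu+\lambda\int_V g u^\alpha\phi\,d\mu.$$ *)

theory Defs
  imports "HOL-Analysis.Infinite_Sum"
begin

text \<open>The vertex set is the type \<open>'v\<close>. An edge between \<open>x\<close> and \<open>y\<close> is
  represented by both ordered pairs \<open>(x, y)\<close> and \<open>(y, x)\<close> in \<open>E\<close>, so the neighbours of \<open>x\<close>
  are \<open>E `` {x}\<close>; values of \<open>\<omega>\<close> off \<open>E\<close> are never used. Loops are not excluded: they contribute
  nothing to \<open>grad_form\<close>.\<close>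

locale weighted_graph =
  fixes E :: "('v \<times> 'v) set"
    and \<omega> :: "'v \<Rightarrow> 'v \<Rightarrow> real"
    and \<mu> :: "'v \<Rightarrow> real"
  assumes edges_sym: "sym E"
    and locally_finite: "\<And>x. finite (E `` {x})"
    and connected: "\<And>x y. (x, y) \<in> E\<^sup>*"
    and weight_pos: "\<And>x y. (x, y) \<in> E \<Longrightarrow> \<omega> x y > 0"
    and weight_sym: "\<And>x y. (x, y) \<in> E \<Longrightarrow> \<omega> x y = \<omega> y x"
    and measure_pos: "\<And>x. \<mu> x > 0"

text \<open>Summability of a real family over \<open>UNIV\<close> is absolute. As \<open>infsum\<close> is \<open>0\<close> on
  non-summable families, integrability is always stated separately.\<close>

definition V_integrable :: "('v \<Rightarrow> real) \<Rightarrow> ('v \<Rightarrow> real) \<Rightarrow> bool" where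
  "V_integrable \<mu> \<psi> \<longleftrightarrow> (\<lambda>x. \<mu> x * \<psi> x) summable_on UNIV"

definition V_integral :: "('v \<Rightarrow> real) \<Rightarrow> ('v \<Rightarrow> real) \<Rightarrow> real" where
  "V_integral \<mu> \<psi> = (\<Sum>\<^sub>\<infinity>x. \<mu> x * \<psi> x)"

definition Lspace :: "('v \<Rightarrow> real) \<Rightarrow> real \<Rightarrow> ('v \<Rightarrow> real) set" where
  "Lspace \<mu> \<theta> = {u. V_integrable \<mu> (\<lambda>x. \<bar>u x\<bar> powr \<theta>)}"

definition Linfty :: "('v \<Rightarrow> real) set" where
  "Linfty = {u. bdd_above (range (\<lambda>x. \<bar>u x\<bar>))}"

definition grad_form ::
  "('v \<times> 'v) set \<Rightarrow> ('v \<Rightarrow> 'v \<Rightarrow> real) \<Rightarrow> ('v \<Rightarrow> real) \<Rightarrow>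
    ('v \<Rightarrow> real) \<Rightarrow> ('v \<Rightarrow> real) \<Rightarrow> 'v \<Rightarrow> real" where
  "grad_form E \<omega> \<mu> u v x =
    1 / (2 * \<mu> x) * (\<Sum>y\<in>E `` {x}. \<omega> x y * (u y - u x) * (v y - v x))"

definition grad_norm ::
  "('v \<times> 'v) set \<Rightarrow> ('v \<Rightarrow> 'v \<Rightarrow> real) \<Rightarrow> ('v \<Rightarrow> real) \<Rightarrow> ('v \<Rightarrow> real) \<Rightarrow> 'v \<Rightarrow> real" where
  "grad_norm E \<omega> \<mu> u x = sqrt (grad_form E \<omega> \<mu> u u x)"

definition W1 ::
  "('v \<times> 'v) set \<Rightarrow> ('v \<Rightarrow> 'v \<Rightarrow> real) \<Rightarrow> ('v \<Rightarrow> real) \<Rightarrow> real \<Rightarrow> ('v \<Rightarrow> real) set" where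
  "W1 E \<omega> \<mu> s =
    {u. V_integrable \<mu> (\<lambda>x. grad_norm E \<omega> \<mu> u x powr s + \<bar>u x\<bar> powr s)}"

definition W1_weighted ::
  "('v \<times> 'v) set \<Rightarrow> ('v \<Rightarrow> 'v \<Rightarrow> real) \<Rightarrow> ('v \<Rightarrow> real) \<Rightarrow>
    ('v \<Rightarrow> real) \<Rightarrow> real \<Rightarrow> ('v \<Rightarrow> real) set" where
  "W1_weighted E \<omega> \<mu> a s =
    {u \<in> W1 E \<omega> \<mu> s. V_integrable \<mu> (\<lambda>x. a x * \<bar>u x\<bar> powr s)}"

text \<open>Integrand of the weak form of \<open>- \<Delta>\<^sub>s u + a u\<^sup>s\<^sup>-\<^sup>1\<close>. Since \<open>0 powr r = 0\<close> for every \<open>r\<close>, its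
  first term is \<open>0\<close> where the gradient of \<open>u\<close> vanishes, as the convention for \<open>s < 2\<close> requires;
  for \<open>s \<ge> 2\<close> this agrees with the usual value, because \<open>grad_form E \<omega> \<mu> u \<phi>\<close> vanishes there too.\<close>

definition weak_integrand ::
  "('v \<times> 'v) set \<Rightarrow> ('v \<Rightarrow> 'v \<Rightarrow> real) \<Rightarrow> ('v \<Rightarrow> real) \<Rightarrow>
    ('v \<Rightarrow> real) \<Rightarrow> real \<Rightarrow> ('v \<Rightarrow> real) \<Rightarrow> ('v \<Rightarrow> real) \<Rightarrow> 'v \<Rightarrow> real" where
  "weak_integrand E \<omega> \<mu> a s u \<phi> x =
    grad_norm E \<omega> \<mu> u x powr (s - 2) * grad_form E \<omega> \<mu> u \<phi> x + a x * u x powr (s - 1) * \<phi> x"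

definition positive_solution ::
  "('v \<times> 'v) set \<Rightarrow> ('v \<Rightarrow> 'v \<Rightarrow> real) \<Rightarrow> ('v \<Rightarrow> real) \<Rightarrow> real \<Rightarrow> real \<Rightarrow> real \<Rightarrow> real \<Rightarrow> real \<Rightarrow>
    ('v \<Rightarrow> real) \<Rightarrow> ('v \<Rightarrow> real) \<Rightarrow> ('v \<Rightarrow> real) \<Rightarrow> ('v \<Rightarrow> real) \<Rightarrow> ('v \<Rightarrow> real) \<Rightarrow> bool" where
  "positive_solution E \<omega> \<mu> p q \<gamma> \<alpha> lam a b f g u \<longleftrightarrow>
    (let W = W1_weighted E \<omega> \<mu> a p \<inter> W1_weighted E \<omega> \<mu> b q in
      u \<in> W \<and> (\<forall>x. u x > 0) \<and>
      (\<forall>\<phi>\<in>W.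
        V_integrable \<mu> (weak_integrand E \<omega> \<mu> a p u \<phi>) \<and>
        V_integrable \<mu> (weak_integrand E \<omega> \<mu> b q u \<phi>) \<and>
        V_integrable \<mu> (\<lambda>x. f x * u x powr (- \<gamma>) * \<phi> x) \<and>
        V_integrable \<mu> (\<lambda>x. g x * u x powr \<alpha> * \<phi> x) \<and>
        V_integral \<mu> (weak_integrand E \<omega> \<mu> a p u \<phi>) +
          V_integral \<mu> (weak_integrand E \<omega> \<mu> b q u \<phi>) =
        V_integral \<mu> (\<lambda>x. f x * u x powr (- \<gamma>) * \<phi> x) +
          lam * V_integral \<mu> (\<lambda>x. g x * u x powr \<alpha> * \<phi> x)))"

end

theory Submission
  imports Defs "HOL-Analysis.Analysis" "HOL-Real_Asymp.Real_Asymp"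
begin

text \<open>
  Since \<open>lam < 0\<close>, the functional
  \<open>J u = \<integral> (|\<nabla>u|\<^sup>p + a |u|\<^sup>p) / p + \<integral> (|\<nabla>u|\<^sup>q + b |u|\<^sup>q) / q
    - lam \<integral> g |u|\<^bsup>\<alpha>+1\<^esup> / (\<alpha> + 1) - \<integral> f (u\<^sup>+)\<^bsup>1-\<gamma>\<^esup> / (1 - \<gamma>)\<close>
  is convex except for its last term, which does not increase under \<open>u \<mapsto> u\<^sup>+\<close>.
  As \<open>\<mu>\<close> is bounded below, functions in \<open>W\<close> are bounded, so it suffices to minimise over a box
  \<open>0 \<le> u \<le> K\<close>, which is compact for pointwise convergence; adding the constant
  \<open>\<integral> f K\<^bsup>1-\<gamma>\<^esup> / (1 - \<gamma>)\<close> turns \<open>J\<close> into a sum of nonnegative continuous terms, hence a lower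
  semicontinuous function. For \<open>K\<close> large the minimiser stays below \<open>K - 1\<close>, so small perturbations
  in any direction of \<open>W\<close> are admissible. Testing with point masses gives \<open>u > 0\<close>, because
  \<open>t\<^bsup>1-\<gamma>\<^esup>\<close> beats every linear term; testing with \<open>|\<phi>|\<close> gives integrability of \<open>f u\<^bsup>-\<gamma>\<^esup> \<phi>\<close>; then the
  dominated one-sided derivatives in the directions \<open>\<phi>\<close> and \<open>-\<phi>\<close> give the weak equation.
  Two solutions are compared by testing both equations with their difference: all terms are monotone.
\<close>

subsection \<open>Powers of seminorms given by a semidefinite form\<close>

text \<open>The tangent inequality for the convex function \<open>x powr s\<close>. Convexity and
  differentiability are used on the open half-line only, so the values 0 are treated by
  hand.\<close>

lemma powr_above_tangent:
  fixes U V s :: real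
  assumes "1 < s" "0 \<le> U" "0 \<le> V"
  shows "U powr s + s * U powr (s - 1) * (V - U) \<le> V powr s"
proof (cases "U = 0 \<or> V = 0")
  case True
  have "U powr (s - 1) * U = U powr s"
    using assms by (cases "U = 0") (auto simp: powr_diff)
  then have "U powr s + s * U powr (s - 1) * (0 - U) = (1 - s) * U powr s"
    by (simp add: algebra_simps)
  moreover have "(1 - s) * U powr s \<le> 0"
    using assms by (intro mult_nonpos_nonneg) auto
  ultimately show ?thesis
    using True by auto
next
  case False
  then have pos: "U > 0" "V > 0" using assms by auto
  have "convex_on {0<..} (\<lambda>x::real. x powr s)"
    using assms by (intro powr_convex) auto
  then have "V powr s - U powr s \<ge> s * U powr (s - 1) * (V - U)"
    using pos
    by (intro convex_on_imp_above_tangent[where A = "{0<..}"])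
       (auto intro!: derivative_eq_intros simp: interior_open)
  then show ?thesis by simp
qed

text \<open>Both the gradient form at a vertex and the product \<open>u x * v x\<close> are forms of
  this kind, so powers of \<open>|\<nabla>u|\<close> and of \<open>|u|\<close> share all the
  following estimates.\<close>

locale psd_form =
  fixes B :: "('v \<Rightarrow> real) \<Rightarrow> ('v \<Rightarrow> real) \<Rightarrow> real"
  assumes add_right: "B u (\<lambda>x. v x + w x) = B u v + B u w"
    and scale_right: "B u (\<lambda>x. c * v x) = c * B u v"
    and commute: "B u v = B v u"
    and nonneg: "0 \<le> B u u"
begin

definition N :: "('v \<Rightarrow> real) \<Rightarrow> real" where
  "N u = sqrt (B u u)"

lemma N_nonneg: "0 \<le> N u"
  by (simp add: N_def nonneg)

lemma N_square: "N u * N u = B u u"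
  by (simp add: N_def nonneg)

lemma add_left: "B (\<lambda>x. v x + w x) u = B v u + B w u"
  by (metis add_right commute)

lemma scale_left: "B (\<lambda>x. c * v x) u = c * B v u"
  by (metis scale_right commute)

lemma diff_right: "B u (\<lambda>x. v x - w x) = B u v - B u w"
  using add_right[of u v "\<lambda>x. (-1) * w x"] scale_right[of u "-1" w] by simp

lemma expand: "B (\<lambda>x. u x + t * v x) (\<lambda>x. u x + t * v x) = B u u + 2 * t * B u v + t\<^sup>2 * B v v"
proof -
  have "B (\<lambda>x. u x + t * v x) w = B u w + t * B v w" for w
    using add_left[of u "\<lambda>x. t * v x" w] scale_left[of t v w] by simp
  moreover have "B w (\<lambda>x. u x + t * v x) = B w u + t * B w v" for w
    using add_right[of w u "\<lambda>x. t * v x"] scale_right[of w t v] by simp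
  ultimately show ?thesis
    using commute[of u v] by (simp add: algebra_simps power2_eq_square)
qed

text \<open>The quadratic polynomial in \<open>t\<close> obtained from \<open>expand\<close> is
  nonnegative; the form may be degenerate, so its leading coefficient can vanish.\<close>

lemma cauchy_schwarz: "\<bar>B u v\<bar> \<le> N u * N v"
proof -
  have 1: "0 \<le> B u u + 2 * t * B u v + t\<^sup>2 * B v v" for t
    using nonneg[of "\<lambda>x. u x + t * v x"] by (simp add: expand)
  have "(B u v)\<^sup>2 \<le> B u u * B v v"
  proof (cases "B v v = 0")
    case True
    have "B u v = 0"
    proof (rule ccontr)
      assume "B u v \<noteq> 0"
      \<comment> \<open>With zero leading coefficient the polynomial is affine in \<open>t\<close>;
        this \<open>t\<close> gives it the value -1.\<close>
      then show False
        using 1[of "- (B u u + 1) / (2 * B u v)"] True by (simp add: field_simps)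
    qed
    then show ?thesis using True by simp
  next
    case False
    then have "B v v > 0" using nonneg[of v] by simp
    \<comment> \<open>The polynomial is evaluated at its minimum point and multiplied by
      \<open>B v v\<close> to clear the denominator.\<close>
    then have "0 \<le> B v v * (B u u + 2 * (- B u v / B v v) * B u v + (- B u v / B v v)\<^sup>2 * B v v)"
      using 1[of "- B u v / B v v"] by (intro mult_nonneg_nonneg) auto
    also have "\<dots> = B u u * B v v - (B u v)\<^sup>2"
      using False by (simp add: field_simps power2_eq_square)
    finally show ?thesis by simp
  qed
  then have "sqrt ((B u v)\<^sup>2) \<le> sqrt (B u u * B v v)"
    by (rule real_sqrt_le_mono)
  then show ?thesis
    by (simp add: N_def real_sqrt_mult)
qed

lemma N_eq_0_imp: "N u = 0 \<Longrightarrow> B u v = 0"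
  using cauchy_schwarz[of u v] by simp

lemma powr_minus_two_mult: "N u powr (s - 2) * (N u * N u) = N u powr s"
  using N_nonneg[of u] by (cases "N u = 0") (auto simp: powr_diff power2_eq_square)

lemma powr_minus_two_bound: "N u powr (s - 2) * B u v \<le> N u powr (s - 1) * N v"
proof -
  have "N u powr (s - 2) * B u v \<le> N u powr (s - 2) * (N u * N v)"
    using cauchy_schwarz[of u v] by (intro mult_left_mono) auto
  also have "\<dots> = N u powr (s - 1) * N v"
    using N_nonneg[of u] by (cases "N u = 0") (auto simp: powr_diff power2_eq_square)
  finally show ?thesis .
qed

text \<open>Cauchy-Schwarz bounds the linear term by \<open>N u powr (s - 1) * (N v - N u)\<close>,
  which leaves the scalar tangent inequality between \<open>N u\<close> and
  \<open>N v\<close>.\<close>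

lemma subgradient:
  assumes "1 < s"
  shows "N u powr s + s * (N u powr (s - 2) * B u (\<lambda>x. v x - u x)) \<le> N v powr s"
proof -
  have "N u powr (s - 2) * B u (\<lambda>x. v x - u x) = N u powr (s - 2) * B u v - N u powr s"
    using powr_minus_two_mult[of u s] by (simp add: diff_right algebra_simps N_square)
  also have "\<dots> \<le> N u powr (s - 1) * N v - N u powr s"
    using powr_minus_two_bound[of u s v] by simp
  also have "\<dots> = N u powr (s - 1) * (N v - N u)"
    using N_nonneg[of u] by (cases "N u = 0") (auto simp: powr_diff field_simps)
  finally have "s * (N u powr (s - 2) * B u (\<lambda>x. v x - u x)) \<le> s * (N u powr (s - 1) * (N v - N u))"
    using assms by (intro mult_left_mono) auto
  then show ?thesis
    using powr_above_tangent[OF assms N_nonneg N_nonneg, of u v] by (simp add: mult.assoc)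
qed

text \<open>The subgradient inequalities at the intermediate point towards both ends are added with
  weights \<open>1 - t\<close> and \<open>t\<close>; the linear terms cancel.\<close>

lemma powr_convex:
  assumes "1 < s" "0 \<le> t" "t \<le> 1"
  shows "N (\<lambda>x. u x + t * v x) powr s \<le> (1 - t) * N u powr s + t * N (\<lambda>x. u x + v x) powr s"
proof -
  define w where "w = (\<lambda>x. u x + t * v x)"
  define G where "G h = s * (N w powr (s - 2) * B w h)" for h
  have G_scale: "G (\<lambda>x. c * h x) = c * G h" for c h
    by (simp add: G_def scale_right)
  have "N w powr s + G (\<lambda>x. u x - w x) \<le> N u powr s"
    unfolding G_def by (rule subgradient[OF assms(1)])
  moreover have "(\<lambda>x. u x - w x) = (\<lambda>x. (- t) * v x)"
    by (auto simp: w_def)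
  ultimately have 1: "N w powr s - t * G v \<le> N u powr s"
    using G_scale[of "-t" v] by simp
  have "N w powr s + G (\<lambda>x. (u x + v x) - w x) \<le> N (\<lambda>x. u x + v x) powr s"
    unfolding G_def by (rule subgradient[OF assms(1)])
  moreover have "(\<lambda>x. (u x + v x) - w x) = (\<lambda>x. (1 - t) * v x)"
    by (auto simp: w_def algebra_simps)
  ultimately have 2: "N w powr s + (1 - t) * G v \<le> N (\<lambda>x. u x + v x) powr s"
    using G_scale[of "1 - t" v] by simp
  have "(1 - t) * (N w powr s - t * G v) + t * (N w powr s + (1 - t) * G v)
      \<le> (1 - t) * N u powr s + t * N (\<lambda>x. u x + v x) powr s"
    using 1 2 assms by (intro add_mono mult_left_mono) auto
  then show ?thesis by (simp add: w_def algebra_simps)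
qed

lemma N_scale: "N (\<lambda>x. c * u x) = \<bar>c\<bar> * N u"
  by (simp add: N_def scale_left scale_right real_sqrt_mult)

text \<open>If \<open>B u u > 0\<close>, this is the chain rule for a quadratic polynomial in
  \<open>t\<close>. Otherwise \<open>N\<close> at \<open>u + t v\<close> equals
  \<open>\<bar>t\<bar> * N v\<close>, whose power \<open>s > 1\<close> has derivative 0 at 0, and
  the claimed derivative is 0 because \<open>B u v = 0\<close>.\<close>

lemma powr_deriv:
  assumes "1 < s"
  shows "((\<lambda>t. N (\<lambda>x. u x + t * v x) powr s) has_real_derivative s * (N u powr (s - 2) * B u v)) (at 0)"
proof (cases "B u u = 0")
  case False
  then have pos: "B u u > 0" using nonneg[of u] by simp
  have *: "N w powr r = B w w powr (r / 2)" for w r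
    using nonneg[of w] by (simp add: N_def powr_half_sqrt[symmetric] powr_powr)
  have **: "B u u powr (s / 2 - 1) = N u powr (s - 2)"
    by (simp add: * diff_divide_distrib)
  have "((\<lambda>t. (B u u + 2 * t * B u v + t\<^sup>2 * B v v) powr (s / 2)) has_real_derivative
      (s / 2 * B u u powr (s / 2 - 1)) * (2 * B u v)) (at 0)"
    using pos by (auto intro!: derivative_eq_intros)
  moreover have "N (\<lambda>x. u x + t * v x) powr s = (B u u + 2 * t * B u v + t\<^sup>2 * B v v) powr (s / 2)" for t
    unfolding * expand ..
  ultimately show ?thesis
    unfolding ** by (simp add: mult.assoc)
next
  case True
  then have N0: "N u = 0" by (simp add: N_def)
  then have B0: "B u v = 0" by (rule N_eq_0_imp)
  have eq: "N (\<lambda>x. u x + t * v x) powr s = \<bar>t\<bar> powr s * N v powr s" for t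
  proof -
    have "N (\<lambda>x. u x + t * v x) = \<bar>t\<bar> * N v"
      by (simp add: N_def expand True B0 real_sqrt_mult)
    then show ?thesis using N_nonneg[of v] by (simp add: powr_mult)
  qed
  have "((\<lambda>h. \<bar>h\<bar> powr (s - 1) * N v powr s) \<longlongrightarrow> 0 powr (s-1) * N v powr s) (at (0::real))"
    using assms by (intro tendsto_intros tendsto_powr') (auto intro!: tendsto_eq_intros)
  then have "((\<lambda>h. \<bar>h\<bar> powr (s - 1) * N v powr s) \<longlongrightarrow> 0) (at (0::real))"
    using assms by simp
  moreover have "\<bar>\<bar>h\<bar> powr s * N v powr s / h\<bar> = \<bar>h\<bar> powr (s - 1) * N v powr s" if "h \<noteq> 0" for h :: real
    using that by (simp add: powr_diff abs_mult)
  ultimately have "((\<lambda>h. \<bar>\<bar>h\<bar> powr s * N v powr s / h\<bar>) \<longlongrightarrow> 0) (at (0::real))"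
    by (simp cong: Lim_cong_within)
  then have "((\<lambda>h. \<bar>h\<bar> powr s * N v powr s / h) \<longlongrightarrow> 0) (at (0::real))"
    by (rule tendsto_rabs_zero_cancel)
  then show ?thesis
    unfolding eq using B0 by (simp add: has_field_derivative_iff)
qed

text \<open>The sum of the subgradient inequality at \<open>u\<close> towards \<open>v\<close> and
  the one at \<open>v\<close> towards \<open>u\<close>.\<close>

lemma monotone:
  assumes "1 < s"
  shows "0 \<le> N u powr (s - 2) * B u (\<lambda>x. u x - v x) - N v powr (s - 2) * B v (\<lambda>x. u x - v x)"
proof -
  have *: "B w (\<lambda>x. v x - u x) = - B w (\<lambda>x. u x - v x)" for w
    by (simp add: diff_right)
  have "N u powr s + s * (N u powr (s - 2) * B u (\<lambda>x. v x - u x)) \<le> N v powr s"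
    "N v powr s + s * (N v powr (s - 2) * B v (\<lambda>x. u x - v x)) \<le> N u powr s"
    using assms by (auto intro: subgradient)
  then have "0 \<le> s * (N u powr (s - 2) * B u (\<lambda>x. u x - v x) - N v powr (s - 2) * B v (\<lambda>x. u x - v x))"
    unfolding * by (simp add: algebra_simps)
  then show ?thesis
    using assms by (simp add: zero_le_mult_iff)
qed

end

section \<open>Convex differentiable functionals\<close>

text \<open>The first clause is the subgradient inequality for the derivative \<open>d u v\<close> of \<open>P\<close> at \<open>u\<close>
  in direction \<open>v\<close>.\<close>

definition convex_diff :: "(('v \<Rightarrow> real) \<Rightarrow> real) \<Rightarrow> (('v \<Rightarrow> real) \<Rightarrow> ('v \<Rightarrow> real) \<Rightarrow> real) \<Rightarrow> bool" where
  "convex_diff P d \<longleftrightarrow>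
    (\<forall>u v. P u + d u v \<le> P (\<lambda>x. u x + v x)) \<and>
    (\<forall>u v t. 0 \<le> t \<longrightarrow> t \<le> 1 \<longrightarrow>
      P (\<lambda>x. u x + t * v x) \<le> (1 - t) * P u + t * P (\<lambda>x. u x + v x)) \<and>
    (\<forall>u v c. d u (\<lambda>x. c * v x) = c * d u v) \<and>
    (\<forall>u v. ((\<lambda>t. P (\<lambda>x. u x + t * v x)) has_real_derivative d u v) (at 0))"

lemma convex_diffD:
  assumes "convex_diff P d"
  shows "P u + d u v \<le> P (\<lambda>x. u x + v x)"
    and "0 \<le> t \<Longrightarrow> t \<le> 1 \<Longrightarrow>
      P (\<lambda>x. u x + t * v x) \<le> (1 - t) * P u + t * P (\<lambda>x. u x + v x)"
    and "d u (\<lambda>x. c * v x) = c * d u v"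
    and "((\<lambda>t. P (\<lambda>x. u x + t * v x)) has_real_derivative d u v) (at 0)"
  using assms unfolding convex_diff_def by blast+

lemma convex_diff_add:
  assumes "convex_diff P d" "convex_diff Q e"
  shows "convex_diff (\<lambda>u. P u + Q u) (\<lambda>u v. d u v + e u v)"
  unfolding convex_diff_def
proof (intro conjI allI impI)
  fix u v :: "'a \<Rightarrow> real" and t :: real assume "0 \<le> t" "t \<le> 1"
  then have "P (\<lambda>x. u x + t * v x) \<le> (1 - t) * P u + t * P (\<lambda>x. u x + v x)"
      "Q (\<lambda>x. u x + t * v x) \<le> (1 - t) * Q u + t * Q (\<lambda>x. u x + v x)"
    using assms by (auto intro: convex_diffD)
  then show "P (\<lambda>x. u x + t * v x) + Q (\<lambda>x. u x + t * v x)
      \<le> (1 - t) * (P u + Q u) + t * (P (\<lambda>x. u x + v x) + Q (\<lambda>x. u x + v x))"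
    by (simp add: algebra_simps)
next
  fix u v :: "'a \<Rightarrow> real"
  have "P u + d u v \<le> P (\<lambda>x. u x + v x)" "Q u + e u v \<le> Q (\<lambda>x. u x + v x)"
    using assms by (auto intro: convex_diffD)
  then show "P u + Q u + (d u v + e u v) \<le> P (\<lambda>x. u x + v x) + Q (\<lambda>x. u x + v x)"
    by simp
qed (simp_all add: convex_diffD(3)[OF assms(1)] convex_diffD(3)[OF assms(2)] distrib_left
    DERIV_add convex_diffD(4)[OF assms(1)] convex_diffD(4)[OF assms(2)])

lemma convex_diff_scale:
  assumes "convex_diff P d" "0 \<le> k"
  shows "convex_diff (\<lambda>u. k * P u) (\<lambda>u v. k * d u v)"
  unfolding convex_diff_def
proof (intro conjI allI impI)
  fix u v :: "'a \<Rightarrow> real" and t :: real assume "0 \<le> t" "t \<le> 1"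
  then have "k * P (\<lambda>x. u x + t * v x) \<le> k * ((1 - t) * P u + t * P (\<lambda>x. u x + v x))"
    using assms by (intro mult_left_mono convex_diffD) auto
  then show "k * P (\<lambda>x. u x + t * v x)
      \<le> (1 - t) * (k * P u) + t * (k * P (\<lambda>x. u x + v x))"
    by (simp add: algebra_simps)
next
  fix u v :: "'a \<Rightarrow> real"
  have "k * (P u + d u v) \<le> k * P (\<lambda>x. u x + v x)"
    using assms by (intro mult_left_mono convex_diffD) auto
  then show "k * P u + k * d u v \<le> k * P (\<lambda>x. u x + v x)"
    by (simp add: algebra_simps)
qed (simp_all add: convex_diffD(3)[OF assms(1)] DERIV_cmult convex_diffD(4)[OF assms(1)])

text \<open>Division by \<open>s\<close> removes the factor \<open>s\<close> from the derivative,
  which thus takes the form occurring in the weak equation.\<close>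

lemma (in psd_form) convex_diff_powr:
  assumes "1 < s"
  shows "convex_diff (\<lambda>u. N u powr s / s) (\<lambda>u v. N u powr (s - 2) * B u v)"
proof -
  have "convex_diff (\<lambda>u. N u powr s) (\<lambda>u v. s * (N u powr (s - 2) * B u v))"
    unfolding convex_diff_def
  proof (intro conjI allI impI)
    fix u v :: "'v \<Rightarrow> real"
    show "N u powr s + s * (N u powr (s - 2) * B u v) \<le> N (\<lambda>x. u x + v x) powr s"
      using subgradient[OF assms, of u "\<lambda>x. u x + v x"] by simp
    show "((\<lambda>t. N (\<lambda>x. u x + t * v x) powr s) has_real_derivative s * (N u powr (s - 2) * B u v)) (at 0)"
      by (rule powr_deriv[OF assms])
    show "s * (N u powr (s - 2) * B u (\<lambda>x. c * v x)) = c * (s * (N u powr (s - 2) * B u v))" for c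
      unfolding scale_right by (simp add: algebra_simps)
  qed (rule powr_convex[OF assms])
  then have "convex_diff (\<lambda>u. 1 / s * N u powr s) (\<lambda>u v. 1 / s * (s * (N u powr (s - 2) * B u v)))"
    using assms by (intro convex_diff_scale) auto
  then show ?thesis
    using assms by simp
qed

text \<open>The subgradient inequality in the directions \<open>v\<close> and \<open>-v\<close>
  encloses the derivative. The bound involves values of \<open>P\<close> only, so derivatives
  inherit summability from energies.\<close>

lemma convex_diff_abs_le:
  assumes "convex_diff P d"
  shows "\<bar>d u v\<bar> \<le> \<bar>P (\<lambda>x. u x + v x) - P u\<bar> + \<bar>P (\<lambda>x. u x - v x) - P u\<bar>"
proof -
  have "P u + d u v \<le> P (\<lambda>x. u x + v x)"
    by (rule convex_diffD(1)[OF assms])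
  moreover have "P u + d u (\<lambda>x. (-1) * v x) \<le> P (\<lambda>x. u x + (-1) * v x)"
    by (rule convex_diffD(1)[OF assms])
  moreover have "d u (\<lambda>x. (-1) * v x) = (-1) * d u v"
    by (rule convex_diffD(3)[OF assms])
  ultimately have "P u + d u v \<le> P (\<lambda>x. u x + v x)" "P u - d u v \<le> P (\<lambda>x. u x - v x)"
    by simp_all
  then show ?thesis by linarith
qed

text \<open>By convexity the quotient lies between \<open>d u v\<close> and
  \<open>P (u + v) - P u\<close>. The bound is independent of \<open>t\<close> and dominates when
  differentiating under an infinite sum.\<close>

lemma convex_diff_quotient_abs_le:
  assumes "convex_diff P d" "0 < t" "t \<le> 1"
  shows "\<bar>(P (\<lambda>x. u x + t * v x) - P u) / t\<bar>
    \<le> \<bar>P (\<lambda>x. u x + v x) - P u\<bar> + \<bar>P (\<lambda>x. u x - v x) - P u\<bar>"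
proof -
  have "P (\<lambda>x. u x + t * v x) \<le> (1 - t) * P u + t * P (\<lambda>x. u x + v x)"
    using assms(2,3) by (intro convex_diffD(2)[OF assms(1)]) auto
  then have up: "(P (\<lambda>x. u x + t * v x) - P u) / t \<le> P (\<lambda>x. u x + v x) - P u"
    using assms by (simp add: field_simps)
  have "P u + d u (\<lambda>x. t * v x) \<le> P (\<lambda>x. u x + t * v x)"
    by (rule convex_diffD(1)[OF assms(1)])
  moreover have "d u (\<lambda>x. t * v x) = t * d u v"
    by (rule convex_diffD(3)[OF assms(1)])
  ultimately have "d u v \<le> (P (\<lambda>x. u x + t * v x) - P u) / t"
    using assms by (simp add: field_simps)
  then show ?thesis
    using up convex_diff_abs_le[OF assms(1), of u v] by linarith
qed

section \<open>Dominated and subtracted summable families\<close>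

lemma summable_on_UNIV_dominated:
  fixes f g :: "'v \<Rightarrow> real"
  assumes "g summable_on UNIV" "\<And>x. \<bar>f x\<bar> \<le> g x"
  shows "f summable_on UNIV"
proof -
  have "(\<lambda>x. \<bar>f x\<bar>) summable_on UNIV"
    using assms(2) by (intro summable_on_comparison_test[OF assms(1)]) auto
  then show ?thesis
    by (subst summable_on_iff_abs_summable_on_real) simp
qed

lemma summable_on_diff_real:
  fixes f g :: "'v \<Rightarrow> real"
  assumes "f summable_on A" "g summable_on A"
  shows "(\<lambda>x. f x - g x) summable_on A"
  using summable_on_add[OF assms(1), of "\<lambda>x. - g x"] assms(2) by (simp add: summable_on_uminus)

lemma infsum_diff_real:
  fixes f g :: "'v \<Rightarrow> real"
  assumes "f summable_on A" "g summable_on A"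
  shows "(\<Sum>\<^sub>\<infinity>x\<in>A. f x - g x) = infsum f A - infsum g A"
  using infsum_add[OF assms(1), of "\<lambda>x. - g x"] assms(2)
  by (simp add: summable_on_uminus infsum_uminus)

lemma summable_on_abs_diff:
  fixes f g :: "'v \<Rightarrow> real"
  assumes "f summable_on A" "g summable_on A"
  shows "(\<lambda>x. \<bar>f x - g x\<bar>) summable_on A"
  using summable_on_diff_real[OF assms]
  by (subst (asm) summable_on_iff_abs_summable_on_real) simp

lemma summable_convex_diff:
  fixes P :: "'w \<Rightarrow> ('v \<Rightarrow> real) \<Rightarrow> real"
  assumes "\<And>x. convex_diff (P x) (d x)"
    and "(\<lambda>x. P x u) summable_on UNIV"
    and "(\<lambda>x. P x (\<lambda>y. u y + v y)) summable_on UNIV"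
    and "(\<lambda>x. P x (\<lambda>y. u y - v y)) summable_on UNIV"
  shows "(\<lambda>x. d x u v) summable_on UNIV"
proof (rule summable_on_UNIV_dominated)
  show "(\<lambda>x. \<bar>P x (\<lambda>y. u y + v y) - P x u\<bar> + \<bar>P x (\<lambda>y. u y - v y) - P x u\<bar>) summable_on UNIV"
    using assms by (intro summable_on_add summable_on_abs_diff)
qed (rule convex_diff_abs_le[OF assms(1)])

subsection \<open>Infinite sums depending on a parameter\<close>

text \<open>Both \<open>b + h\<close> and \<open>b - h\<close> are nonnegative, so their finite sums
  stay below their infinite sums.\<close>

lemma infsum_truncation_error:
  fixes h b :: "'v \<Rightarrow> real"
  assumes "b summable_on UNIV" "\<And>x. \<bar>h x\<bar> \<le> b x" "finite A"
  shows "\<bar>sum h A - infsum h UNIV\<bar> \<le> infsum b UNIV - sum b A"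
proof -
  have h: "h summable_on UNIV"
    by (rule summable_on_UNIV_dominated[OF assms(1,2)])
  have bh: "0 \<le> b x + h x" "0 \<le> b x - h x" for x
    using assms(2)[of x] by linarith+
  have "sum (\<lambda>x. b x + h x) A \<le> infsum (\<lambda>x. b x + h x) UNIV"
    using bh assms(3) by (intro finite_sum_le_infsum summable_on_add assms(1) h) auto
  moreover have "sum (\<lambda>x. b x - h x) A \<le> infsum (\<lambda>x. b x - h x) UNIV"
    using bh assms(3) by (intro finite_sum_le_infsum summable_on_diff_real assms(1) h) auto
  ultimately show ?thesis
    using assms(1) h by (simp add: infsum_add infsum_diff_real sum.distrib sum_subtractf)
qed

text \<open>Dominated convergence for difference quotients. A finite set carries all but
  \<open>e / 2\<close> of the dominating sum; truncating costs \<open>e / 2\<close> before the limit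
  in \<open>t\<close> and \<open>e / 2\<close> again after it.\<close>

lemma infsum_right_derivative_nonneg:
  fixes H :: "'v \<Rightarrow> real \<Rightarrow> real"
  assumes "0 < t0"
    and deriv: "\<And>x. (H x has_real_derivative d x) (at 0)"
    and bound: "\<And>x t. 0 < t \<Longrightarrow> t \<le> t0 \<Longrightarrow> \<bar>(H x t - H x 0) / t\<bar> \<le> b x"
    and b: "b summable_on UNIV"
    and nonneg: "\<And>t. 0 < t \<Longrightarrow> t \<le> t0 \<Longrightarrow> 0 \<le> (\<Sum>\<^sub>\<infinity>x. H x t - H x 0)"
  shows "0 \<le> infsum d UNIV"
proof (rule field_le_epsilon)
  have ev: "\<forall>\<^sub>F t in at_right 0. 0 < t \<and> t \<le> t0"
    using \<open>0 < t0\<close> by (auto simp: eventually_at_right intro!: exI[of _ t0])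
  have lim: "((\<lambda>t. (H x t - H x 0) / t) \<longlongrightarrow> d x) (at_right 0)" for x
    using deriv[of x] unfolding has_field_derivative_iff
    by (auto intro: tendsto_mono[OF at_le])
  have d: "\<bar>d x\<bar> \<le> b x" for x
    by (rule tendsto_upperbound[OF tendsto_rabs[OF lim]])
       (use ev in \<open>auto elim!: eventually_mono intro: bound simp del: abs_divide\<close>)
  fix e :: real assume "0 < e"
  then obtain A where A: "finite A" "dist (sum b A) (infsum b UNIV) \<le> e / 2"
    using infsum_finite_approximation[OF b, of "e / 2"] by auto
  then have tail: "infsum b UNIV - sum b A \<le> e / 2"
    unfolding dist_real_def by linarith
  have "- (e / 2) \<le> (\<Sum>x\<in>A. (H x t - H x 0) / t)" if "0 < t" "t \<le> t0" for t
  proof -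
    have "(\<Sum>\<^sub>\<infinity>x. (H x t - H x 0) / t) = (\<Sum>\<^sub>\<infinity>x. H x t - H x 0) / t"
      using infsum_cmult_left'[of "\<lambda>x. H x t - H x 0" "1 / t" UNIV] by simp
    then have "0 \<le> (\<Sum>\<^sub>\<infinity>x. (H x t - H x 0) / t)"
      using nonneg that by simp
    then show ?thesis
      using infsum_truncation_error[OF b bound[OF that] A(1)] tail by (auto simp: abs_le_iff)
  qed
  then have "- (e / 2) \<le> sum d A"
    by (intro tendsto_lowerbound[OF tendsto_sum[OF lim]])
       (use ev in \<open>auto elim!: eventually_mono\<close>)
  then show "0 \<le> infsum d UNIV + e"
    using infsum_truncation_error[OF b d A(1)] tail by (auto simp: abs_le_iff)
qed

text \<open>A sum of nonnegative continuous terms is a supremum of continuous partial sums, hence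
  lower semicontinuous. Minimality becomes a family of closed conditions with the finite
  intersection property.\<close>

lemma compact_infsum_attains_inf:
  fixes T :: "'v \<Rightarrow> 'b::topological_space \<Rightarrow> real"
  assumes "compact S" and cont: "\<And>x. continuous_on UNIV (T x)"
    and S: "closed S"
    and nonneg: "\<And>x u. u \<in> S \<Longrightarrow> 0 \<le> T x u"
    and v0: "v0 \<in> S" "(\<lambda>x. T x v0) summable_on UNIV"
  obtains u where "u \<in> S" "(\<lambda>x. T x u) summable_on UNIV"
    "\<And>v. v \<in> S \<Longrightarrow> (\<lambda>x. T x v) summable_on UNIV \<Longrightarrow> (\<Sum>\<^sub>\<infinity>x. T x u) \<le> (\<Sum>\<^sub>\<infinity>x. T x v)"
proof -
  \<comment> \<open>\<open>u\<close> is a minimiser iff every finite partial sum at \<open>u\<close> is at most every competitor's value\<close>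
  define I where "I = {(A :: 'v set, v). finite A \<and> v \<in> S \<and> (\<lambda>x. T x v) summable_on UNIV}"
  define C where "C = (\<lambda>(A, v). {u. (\<Sum>x\<in>A. T x u) \<le> (\<Sum>\<^sub>\<infinity>x. T x v)})"
  have "S \<inter> (\<Inter>i\<in>I. C i) \<noteq> {}"
  proof (rule compact_imp_fip_image[OF \<open>compact S\<close>])
    fix i assume "i \<in> I"
    show "closed (C i)"
      unfolding C_def case_prod_unfold
      by (intro closed_Collect_le continuous_intros cont)
  next
    fix I' assume I': "finite I'" "I' \<subseteq> I"
    show "S \<inter> (\<Inter>i\<in>I'. C i) \<noteq> {}"
    proof (cases "I' = {}")
      case True
      then show ?thesis using v0 by auto
    next
      case False
      define J where "J = (\<lambda>i :: 'v set \<times> 'b. \<Sum>\<^sub>\<infinity>x. T x (snd i))"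
      \<comment> \<open>Among finitely many competitors, one of least value meets all the finitely
        many conditions, since its partial sums do not exceed its full sum.\<close>
      obtain i where i: "i \<in> I'" "\<And>j. j \<in> I' \<Longrightarrow> J i \<le> J j"
        using ex_min_if_finite[of "J ` I'"] I' False by (force simp: not_less)
      have "snd i \<in> S" "(\<lambda>x. T x (snd i)) summable_on UNIV"
        using i I' by (auto simp: I_def)
      moreover have "snd i \<in> C j" if "j \<in> I'" for j
      proof -
        have "finite (fst j)" using that I' by (auto simp: I_def)
        then have "(\<Sum>x\<in>fst j. T x (snd i)) \<le> J i"
          using calculation unfolding J_def by (intro finite_sum_le_infsum) (auto intro: nonneg)
        also have "\<dots> \<le> J j" by (rule i(2)[OF that])
        finally show ?thesis by (simp add: C_def J_def case_prod_unfold)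
      qed
      ultimately show ?thesis by blast
    qed
  qed
  then obtain u where u: "u \<in> S" "\<And>i. i \<in> I \<Longrightarrow> u \<in> C i" by blast
  have le: "(\<Sum>x\<in>A. T x u) \<le> (\<Sum>\<^sub>\<infinity>x. T x v)"
    if "finite A" "v \<in> S" "(\<lambda>x. T x v) summable_on UNIV" for A v
    using u(2)[of "(A, v)"] that by (auto simp: I_def C_def)
  have summ: "(\<lambda>x. T x u) summable_on UNIV"
  proof (rule nonneg_bdd_above_summable_on)
    show "bdd_above (sum (\<lambda>x. T x u) ` {F. F \<subseteq> UNIV \<and> finite F})"
      by (rule bdd_aboveI2[where M = "\<Sum>\<^sub>\<infinity>x. T x v0"]) (use le v0 in auto)
  qed (use nonneg u in auto)
  show thesis
    by (rule that[OF u(1) summ]) (rule infsum_le_finite_sums[OF summ], rule le)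
qed

text \<open>After division by \<open>u\<close> the claim compares \<open>m powr e\<close> with 1,
  where \<open>m\<close> is the ratio of the new value to \<open>u\<close>. As
  \<open>m powr e\<close> lies between 1 and \<open>m\<close>, it is no farther from 1 than
  \<open>m\<close> is. Truncation at 0 admits perturbations \<open>r\<close> of any size and
  sign.\<close>

lemma max_powr_diff_le:
  fixes u r e :: real
  assumes "0 < u" "0 < e" "e < 1"
  shows "\<bar>max 0 (u + r) powr e - u powr e\<bar> \<le> u powr (e - 1) * \<bar>r\<bar>"
proof -
  define m where "m = max 0 (1 + r / u)"
  have m: "max 0 (u + r) = u * m" "0 \<le> m"
    using assms by (auto simp: m_def max_def field_simps)
  have "\<bar>m powr e - 1\<bar> \<le> \<bar>r / u\<bar>"
  proof (cases "1 \<le> m")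
    case True
    then have "1 \<le> m powr e" "m powr e \<le> m"
      using assms powr_mono[of e 1 m] by (auto intro: ge_one_powr_ge_zero)
    moreover have "m - 1 \<le> \<bar>r / u\<bar>"
      using True unfolding m_def by linarith
    ultimately show ?thesis by linarith
  next
    case False
    have "m powr e \<le> 1" using False m assms by (intro powr_le1) auto
    moreover have "m \<le> m powr e"
      using powr_mono'[of e 1 m] False m assms by auto
    ultimately show ?thesis
      using False unfolding m_def by linarith
  qed
  then have "u powr e * \<bar>m powr e - 1\<bar> \<le> u powr e * \<bar>r / u\<bar>"
    by (intro mult_left_mono) auto
  moreover have "u powr e * \<bar>m powr e - 1\<bar> = \<bar>u powr e * (m powr e - 1)\<bar>"
    by (simp add: abs_mult)
  moreover have "u powr e * (m powr e - 1) = max 0 (u + r) powr e - u powr e"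
    using assms m by (simp add: powr_mult algebra_simps)
  moreover have "u powr e * \<bar>r / u\<bar> = u powr (e - 1) * \<bar>r\<bar>"
    using assms by (simp add: powr_diff)
  ultimately show ?thesis by simp
qed

section \<open>Compactness for pointwise convergence, and bounds from coercivity\<close>

lemma compact_function_box: "compact {u :: 'v \<Rightarrow> real. \<forall>x. 0 \<le> u x \<and> u x \<le> K}"
proof -
  have "compactin (product_topology (\<lambda>_. euclidean) UNIV) (PiE UNIV (\<lambda>_::'v. {0..K}))"
    by (subst compactin_PiE) auto
  moreover have "PiE UNIV (\<lambda>_::'v. {0..K}) = {u. \<forall>x. 0 \<le> u x \<and> u x \<le> K}"
    by auto
  ultimately show ?thesis
    by (simp add: euclidean_product_topology)
qed

lemma closed_function_box: "closed {u :: 'v \<Rightarrow> real. \<forall>x. 0 \<le> u x \<and> u x \<le> K}"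
  by (intro closed_Collect_all closed_Collect_conj closed_Collect_le continuous_intros) auto

text \<open>Each term is at most the whole sum. Taking the maximum with 1 avoids a root: beyond 1,
  \<open>\<bar>u x\<bar>\<close> is at most its power \<open>p\<close>.\<close>

lemma summable_coercive_bounded:
  fixes u P :: "'v \<Rightarrow> real"
  assumes "P summable_on UNIV" "0 < c" "1 < p" and coercive: "\<And>x. c * \<bar>u x\<bar> powr p \<le> P x"
  obtains M where "1 \<le> M" "\<And>x. \<bar>u x\<bar> \<le> M"
proof
  show "1 \<le> max 1 (infsum P UNIV / c)" by simp
  fix x
  have nonneg: "0 \<le> P x" for x
    using \<open>0 < c\<close> by (intro order_trans[OF _ coercive]) auto
  have "c * \<bar>u x\<bar> powr p \<le> sum P {x}"
    using coercive by simp
  also have "\<dots> \<le> infsum P UNIV"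
    using assms(1) nonneg by (intro finite_sum_le_infsum) auto
  finally have *: "\<bar>u x\<bar> powr p \<le> infsum P UNIV / c"
    using \<open>0 < c\<close> by (simp add: field_simps)
  show "\<bar>u x\<bar> \<le> max 1 (infsum P UNIV / c)"
  proof (cases "\<bar>u x\<bar> \<le> 1")
    case False
    then have "\<bar>u x\<bar> powr 1 \<le> \<bar>u x\<bar> powr p"
      using \<open>1 < p\<close> by (intro powr_mono) auto
    then show ?thesis using * False by simp
  qed auto
qed

subsection \<open>An abstract singular minimisation problem\<close>

text \<open>\<open>\<Phi> x u\<close> is the contribution of the vertex \<open>x\<close> to the
  convex part of the functional; the vertex measure is absorbed into \<open>\<Phi>\<close> and
  \<open>F\<close>. The contraction property is used for positive parts, absolute values and
  negation.\<close>

locale singular_variational =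
  fixes \<Phi> :: "'v \<Rightarrow> ('v \<Rightarrow> real) \<Rightarrow> real"
    and d\<Phi> :: "'v \<Rightarrow> ('v \<Rightarrow> real) \<Rightarrow> ('v \<Rightarrow> real) \<Rightarrow> real"
    and F :: "'v \<Rightarrow> real" and \<gamma> c p :: real
  assumes \<gamma>: "0 < \<gamma>" "\<gamma> < 1" and c: "0 < c" and p: "1 < p"
    and F_pos: "\<And>x. 0 < F x" and F_summable: "F summable_on UNIV"
    and \<Phi>_diff: "\<And>x. convex_diff (\<Phi> x) (d\<Phi> x)"
    and \<Phi>_nonneg: "\<And>x u. 0 \<le> \<Phi> x u"
    and \<Phi>_zero: "\<And>x. \<Phi> x (\<lambda>_. 0) = 0"
    and \<Phi>_contraction: "\<And>x u v. (\<And>y. \<bar>v y\<bar> \<le> \<bar>u y\<bar>) \<Longrightarrow> (\<And>y z. \<bar>v y - v z\<bar> \<le> \<bar>u y - u z\<bar>) \<Longrightarrow>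
      \<Phi> x v \<le> \<Phi> x u"
    and \<Phi>_continuous: "\<And>x. continuous_on UNIV (\<Phi> x)"
    and \<Phi>_coercive: "\<And>x u. c * \<bar>u x\<bar> powr p \<le> \<Phi> x u"
    and domain_linear: "\<And>u v t. (\<lambda>x. \<Phi> x u) summable_on UNIV \<Longrightarrow> (\<lambda>x. \<Phi> x v) summable_on UNIV \<Longrightarrow>
      (\<lambda>x. \<Phi> x (\<lambda>y. u y + t * v y)) summable_on UNIV"
    and domain_delta: "\<And>z. (\<lambda>x. \<Phi> x (\<lambda>y. if y = z then 1 else 0)) summable_on UNIV"
begin

abbreviation finite_energy :: "('v \<Rightarrow> real) \<Rightarrow> bool" where
  "finite_energy u \<equiv> (\<lambda>x. \<Phi> x u) summable_on UNIV"

text \<open>The antiderivative of \<open>F x * t powr (- \<gamma>)\<close> that vanishes at 0,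
  extended by 0 to negative values so that it is defined for every competitor.\<close>

definition \<psi> :: "'v \<Rightarrow> ('v \<Rightarrow> real) \<Rightarrow> real" where
  "\<psi> x u = F x / (1 - \<gamma>) * max 0 (u x) powr (1 - \<gamma>)"

lemma finite_energy_bounded:
  assumes "finite_energy u"
  obtains M where "1 \<le> M" "\<And>x. \<bar>u x\<bar> \<le> M"
  by (rule summable_coercive_bounded[OF assms c p \<Phi>_coercive]) blast

lemma \<psi>_nonneg: "0 \<le> \<psi> x u"
  using F_pos[of x] \<gamma> by (simp add: \<psi>_def)

lemma \<psi>_mono: "u x \<le> v x \<Longrightarrow> \<psi> x u \<le> \<psi> x v"
  unfolding \<psi>_def using F_pos[of x] \<gamma> by (intro mult_left_mono powr_mono2) auto

lemma \<psi>_le: "u x \<le> K \<Longrightarrow> 0 \<le> K \<Longrightarrow> \<psi> x u \<le> F x / (1 - \<gamma>) * K powr (1 - \<gamma>)"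
  unfolding \<psi>_def using F_pos[of x] \<gamma> by (intro mult_left_mono powr_mono2) auto

lemma F_scaled_summable: "(\<lambda>x. F x / (1 - \<gamma>) * k) summable_on UNIV"
  using summable_on_cmult_left[OF F_summable, of "k / (1 - \<gamma>)"] by simp

lemma \<psi>_summable:
  assumes "finite_energy u"
  shows "(\<lambda>x. \<psi> x u) summable_on UNIV"
proof -
  obtain M where M: "1 \<le> M" "\<And>x. \<bar>u x\<bar> \<le> M" using finite_energy_bounded[OF assms] by blast
  have "u x \<le> M" for x using M(2)[of x] by simp
  then show ?thesis
    using M(1) \<psi>_le \<psi>_nonneg
    by (intro summable_on_UNIV_dominated[OF F_scaled_summable[of "M powr (1 - \<gamma>)"]]) simp
qed

lemma finite_energy_pos_part:
  assumes "finite_energy u"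
  shows "finite_energy (\<lambda>x. max 0 (u x))" "\<Phi> x (\<lambda>x. max 0 (u x)) \<le> \<Phi> x u"
proof -
  show *: "\<Phi> x (\<lambda>x. max 0 (u x)) \<le> \<Phi> x u" for x
    by (rule \<Phi>_contraction) auto
  show "finite_energy (\<lambda>x. max 0 (u x))"
    by (rule summable_on_UNIV_dominated[OF assms]) (use * \<Phi>_nonneg in auto)
qed

lemma finite_energy_abs: "finite_energy u \<Longrightarrow> finite_energy (\<lambda>x. \<bar>u x\<bar>)"
  by (erule summable_on_UNIV_dominated) (use \<Phi>_nonneg in \<open>auto intro!: \<Phi>_contraction\<close>)

text \<open>Competitors may take negative values, and the gap between \<open>K - 1\<close> and \<open>K\<close> leaves room for
  small bounded perturbations.\<close>

definition minimiser :: "real \<Rightarrow> ('v \<Rightarrow> real) \<Rightarrow> bool" where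
  "minimiser K u \<longleftrightarrow> finite_energy u \<and> (\<forall>x. 0 \<le> u x \<and> u x \<le> K - 1) \<and>
    (\<forall>v. finite_energy v \<longrightarrow> (\<forall>x. v x \<le> K) \<longrightarrow>
      (\<Sum>\<^sub>\<infinity>x. \<Phi> x u) - (\<Sum>\<^sub>\<infinity>x. \<psi> x u) \<le> (\<Sum>\<^sub>\<infinity>x. \<Phi> x v) - (\<Sum>\<^sub>\<infinity>x. \<psi> x v))"

section \<open>Minimisation in a box\<close>

lemma large_box:
  fixes S :: real
  shows "\<exists>K\<ge>1. S * K powr (1 - \<gamma>) < c * (K - 1) powr p"
proof -
  have "filterlim (\<lambda>x::real. x powr (p - (1 - \<gamma>))) at_top at_top"
    using p \<gamma> by real_asymp
  \<comment> \<open>The factor \<open>2 powr p\<close> pays for replacing \<open>K - 1\<close> by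
    \<open>K / 2\<close>, which is allowed once \<open>K \<ge> 2\<close>.\<close>
  then have "\<forall>\<^sub>F x in at_top. S * 2 powr p / c < x powr (p - (1 - \<gamma>))"
    by (simp add: filterlim_at_top_dense)
  then have "\<forall>\<^sub>F x in at_top. S * 2 powr p / c < x powr (p - (1 - \<gamma>)) \<and> (2::real) \<le> x"
    by (intro eventually_conj eventually_ge_at_top)
  then obtain K where K: "S * 2 powr p / c < K powr (p - (1 - \<gamma>))" "2 \<le> K"
    by (auto simp: eventually_at_top_linorder)
  have "S * K powr (1 - \<gamma>) = c * (S * 2 powr p / c) * K powr (1 - \<gamma>) / 2 powr p"
    using c by simp
  also have "\<dots> < c * K powr (p - (1 - \<gamma>)) * K powr (1 - \<gamma>) / 2 powr p"
    using K c by (intro divide_strict_right_mono mult_strict_right_mono mult_strict_left_mono) auto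
  also have "\<dots> = c * (K / 2) powr p"
    using K by (simp add: powr_divide mult.assoc flip: powr_add)
  also have "\<dots> \<le> c * (K - 1) powr p"
    using K c p by (intro mult_left_mono powr_mono2) auto
  finally show ?thesis using K by (intro exI[of _ K]) auto
qed

lemma ex_minimiser: "\<exists>K u. 1 \<le> K \<and> minimiser K u"
proof -
  obtain K where K: "1 \<le> K"
      "(\<Sum>\<^sub>\<infinity>x. F x / (1 - \<gamma>)) * K powr (1 - \<gamma>) < c * (K - 1) powr p"
    using large_box by blast
  define \<kappa> where "\<kappa> x = F x / (1 - \<gamma>) * K powr (1 - \<gamma>)" for x
  have \<kappa>: "\<kappa> summable_on UNIV" unfolding \<kappa>_def by (rule F_scaled_summable)
  \<comment> \<open>On the box \<open>\<psi> \<le> \<kappa>\<close>, so every term is nonnegative,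
    while the summable \<open>\<kappa>\<close> shifts the functional only by a constant.\<close>
  define T where "T x u = \<Phi> x u + (\<kappa> x - \<psi> x u)" for x u
  define S where "S = {u :: 'v \<Rightarrow> real. \<forall>x. 0 \<le> u x \<and> u x \<le> K}"
  have \<psi>\<kappa>: "\<psi> x u \<le> \<kappa> x" if "u \<in> S" for x u
    unfolding \<kappa>_def using that K by (intro \<psi>_le) (auto simp: S_def)
  have T_cont: "continuous_on UNIV (T x)" for x
    unfolding T_def \<psi>_def using \<gamma>
    by (intro continuous_intros \<Phi>_continuous continuous_on_powr') auto
  have T_sum: "(\<lambda>x. T x u) summable_on UNIV"
    "(\<Sum>\<^sub>\<infinity>x. T x u) = (\<Sum>\<^sub>\<infinity>x. \<Phi> x u) + (infsum \<kappa> UNIV - (\<Sum>\<^sub>\<infinity>x. \<psi> x u))" if "finite_energy u" for u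
    unfolding T_def using that \<kappa> \<psi>_summable[OF that]
    by (simp_all add: summable_on_add infsum_add summable_on_diff_real infsum_diff_real)
  have T_zero: "T x (\<lambda>_. 0) = \<kappa> x" for x
    by (simp add: T_def \<Phi>_zero \<psi>_def)
  obtain u where u: "u \<in> S" "(\<lambda>x. T x u) summable_on UNIV"
    and min: "\<And>v. v \<in> S \<Longrightarrow> (\<lambda>x. T x v) summable_on UNIV \<Longrightarrow> (\<Sum>\<^sub>\<infinity>x. T x u) \<le> (\<Sum>\<^sub>\<infinity>x. T x v)"
  proof (rule compact_infsum_attains_inf[of S T "\<lambda>_. 0"])
    show "compact S" "closed S"
      unfolding S_def by (rule compact_function_box closed_function_box)+
    show "0 \<le> T x u" if "u \<in> S" for x u
      using \<Phi>_nonneg[of x u] \<psi>\<kappa>[OF that, of x] by (simp add: T_def)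
  qed (use K T_cont \<kappa> T_zero in \<open>auto simp: S_def\<close>)
  have finite_energy: "finite_energy u"
    by (rule summable_on_UNIV_dominated[OF u(2)])
       (use \<Phi>_nonneg \<psi>\<kappa>[OF u(1)] in \<open>auto simp: T_def\<close>)
  \<comment> \<open>A larger value at a single vertex would already cost
    \<open>c * (K - 1) powr p\<close>, which exceeds the value of the zero function, the sum of
    \<open>\<kappa>\<close>.\<close>
  have "u x \<le> K - 1" for x
  proof (rule ccontr)
    assume "\<not> u x \<le> K - 1"
    then have "c * (K - 1) powr p \<le> c * \<bar>u x\<bar> powr p"
      using K c p by (intro mult_left_mono powr_mono2) auto
    also have "\<dots> \<le> \<Phi> x u" by (rule \<Phi>_coercive)
    also have "\<dots> \<le> (\<Sum>x\<in>{x}. T x u)"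
      using \<psi>\<kappa>[OF u(1)] by (simp add: T_def)
    also have "\<dots> \<le> (\<Sum>\<^sub>\<infinity>x. T x u)"
      using u \<Phi>_nonneg \<psi>\<kappa>[OF u(1)] by (intro finite_sum_le_infsum) (auto simp: T_def)
    also have "\<dots> \<le> (\<Sum>\<^sub>\<infinity>x. T x (\<lambda>_. 0))"
      using K \<kappa> by (intro min) (auto simp: S_def T_zero)
    also have "\<dots> = (\<Sum>\<^sub>\<infinity>x. F x / (1 - \<gamma>)) * K powr (1 - \<gamma>)"
      unfolding T_zero \<kappa>_def by (rule infsum_cmult_left')
    finally show False using K by simp
  qed
  moreover have "(\<Sum>\<^sub>\<infinity>x. \<Phi> x u) - (\<Sum>\<^sub>\<infinity>x. \<psi> x u) \<le> (\<Sum>\<^sub>\<infinity>x. \<Phi> x v) - (\<Sum>\<^sub>\<infinity>x. \<psi> x v)"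
    if v: "finite_energy v" "\<And>x. v x \<le> K" for v
  proof -
    \<comment> \<open>The positive part brings a signed competitor into the box, keeps
      \<open>\<psi>\<close> and does not raise \<open>\<Phi>\<close>.\<close>
    define v' where "v' = (\<lambda>x. max 0 (v x))"
    have v': "finite_energy v'" "\<Phi> x v' \<le> \<Phi> x v" "\<psi> x v' = \<psi> x v" for x
      using finite_energy_pos_part[OF v(1)] by (auto simp: v'_def \<psi>_def)
    have "(\<Sum>\<^sub>\<infinity>x. T x u) \<le> (\<Sum>\<^sub>\<infinity>x. T x v')"
      using v(2) K by (intro min T_sum v') (auto simp: S_def v'_def)
    then have "(\<Sum>\<^sub>\<infinity>x. \<Phi> x u) - (\<Sum>\<^sub>\<infinity>x. \<psi> x u) \<le> (\<Sum>\<^sub>\<infinity>x. \<Phi> x v') - (\<Sum>\<^sub>\<infinity>x. \<psi> x v)"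
      using T_sum(2)[OF finite_energy] T_sum(2)[OF v'(1)] v'(3) by simp
    also have "\<dots> \<le> (\<Sum>\<^sub>\<infinity>x. \<Phi> x v) - (\<Sum>\<^sub>\<infinity>x. \<psi> x v)"
      using infsum_mono[OF v'(1) v(1) v'(2)] by simp
    finally show ?thesis .
  qed
  ultimately have "minimiser K u"
    using finite_energy u(1) by (auto simp: minimiser_def S_def)
  then show ?thesis using K by blast
qed

section \<open>First variation at the minimiser\<close>

lemma \<psi>_deriv:
  assumes "0 < u x"
  shows "((\<lambda>t. \<psi> x (\<lambda>y. u y + t * v y)) has_real_derivative F x * u x powr (- \<gamma>) * v x) (at 0)"
proof -
  have "((\<lambda>t. u x + t * v x) \<longlongrightarrow> u x) (nhds 0)"
    by (auto intro!: tendsto_eq_intros filterlim_ident)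
  \<comment> \<open>For small \<open>t\<close> the truncation in \<open>\<psi>\<close> is inactive,
    and a smooth power remains.\<close>
  then have ev: "\<forall>\<^sub>F t in nhds 0. 0 < u x + t * v x"
    using assms by (rule order_tendstoD)
  have "((\<lambda>t. F x / (1 - \<gamma>) * (u x + t * v x) powr (1 - \<gamma>)) has_real_derivative
      F x * u x powr (- \<gamma>) * v x) (at 0)"
    using assms \<gamma> by (auto intro!: derivative_eq_intros)
  moreover have "\<forall>\<^sub>F t in nhds 0. F x / (1 - \<gamma>) * (u x + t * v x) powr (1 - \<gamma>) = \<psi> x (\<lambda>y. u y + t * v y)"
    using ev by eventually_elim (auto simp: \<psi>_def max_def)
  ultimately show ?thesis
    by (subst (asm) DERIV_cong_ev[OF refl _ refl]) auto
qed

lemma \<psi>_increment: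
  assumes "0 < u x"
  shows "\<bar>\<psi> x (\<lambda>y. u y + t * v y) - \<psi> x u\<bar> \<le> \<bar>t\<bar> * (F x * u x powr (- \<gamma>) * \<bar>v x\<bar> / (1 - \<gamma>))"
proof -
  have "\<bar>\<psi> x (\<lambda>y. u y + t * v y) - \<psi> x u\<bar> =
      F x / (1 - \<gamma>) * \<bar>max 0 (u x + t * v x) powr (1 - \<gamma>) - u x powr (1 - \<gamma>)\<bar>"
    using assms F_pos[of x] \<gamma> unfolding \<psi>_def right_diff_distrib[symmetric] abs_mult by simp
  also have "\<dots> \<le> F x / (1 - \<gamma>) * (u x powr ((1 - \<gamma>) - 1) * \<bar>t * v x\<bar>)"
    using assms F_pos[of x] \<gamma> by (intro mult_left_mono max_powr_diff_le) auto
  finally show ?thesis by (simp add: abs_mult mult_ac)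
qed


text \<open>A direction bounded by \<open>M\<close> moves values up by at most 1 for
  \<open>t \<le> 1 / M\<close>, which the gap between \<open>K - 1\<close> and \<open>K\<close>
  absorbs.\<close>

lemma minimiser_perturb:
  assumes u: "minimiser K u" and v: "finite_energy v"
  obtains t0 where "0 < t0" "t0 \<le> 1" "\<And>t. 0 < t \<Longrightarrow> t \<le> t0 \<Longrightarrow>
    (\<Sum>\<^sub>\<infinity>x. \<psi> x (\<lambda>y. u y + t * v y)) - (\<Sum>\<^sub>\<infinity>x. \<psi> x u) \<le>
    (\<Sum>\<^sub>\<infinity>x. \<Phi> x (\<lambda>y. u y + t * v y)) - (\<Sum>\<^sub>\<infinity>x. \<Phi> x u)"
proof -
  obtain M where M: "1 \<le> M" "\<And>x. \<bar>v x\<bar> \<le> M"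
    using finite_energy_bounded[OF v] by blast
  have "u x + t * v x \<le> K" if "0 < t" "t \<le> 1 / M" for t x
  proof -
    have "t * v x \<le> t * M"
      using M(2)[of x] that by (intro mult_left_mono) auto
    also have "\<dots> \<le> 1"
      using that M(1) by (simp add: field_simps)
    moreover have "u x \<le> K - 1"
      using u by (simp add: minimiser_def)
    ultimately show ?thesis by linarith
  qed
  then have "(\<Sum>\<^sub>\<infinity>x. \<Phi> x u) - (\<Sum>\<^sub>\<infinity>x. \<psi> x u) \<le>
      (\<Sum>\<^sub>\<infinity>x. \<Phi> x (\<lambda>y. u y + t * v y)) - (\<Sum>\<^sub>\<infinity>x. \<psi> x (\<lambda>y. u y + t * v y))"
    if "0 < t" "t \<le> 1 / M" for t
    using u domain_linear[of u v t] v that unfolding minimiser_def by blast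
  then show thesis
    using M(1) by (intro that[of "1 / M"]) (auto simp: algebra_simps)
qed

text \<open>Minimality bounds the gain in \<open>\<psi>\<close> by the increase of
  \<open>\<Phi>\<close>, and convexity bounds that by \<open>t * D\<close>, with \<open>D\<close>
  independent of \<open>t\<close> and \<open>A\<close>. As \<open>v \<ge> 0\<close>, all increments
  of \<open>\<psi>\<close> are nonnegative and partial sums obey the same bound. Positivity and
  integrability both follow from this estimate.\<close>

lemma minimiser_singular_bound:
  assumes u: "minimiser K u" and v: "finite_energy v" "\<And>x. 0 \<le> v x"
  obtains t0 D where "0 < t0" "\<And>t A. 0 < t \<Longrightarrow> t \<le> t0 \<Longrightarrow> finite A \<Longrightarrow>
    (\<Sum>x\<in>A. (\<psi> x (\<lambda>y. u y + t * v y) - \<psi> x u) / t) \<le> D"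
proof -
  have du: "finite_energy u" using u by (simp add: minimiser_def)
  have duv: "finite_energy (\<lambda>y. u y + t * v y)" for t using domain_linear du v by blast
  define D where "D = (\<Sum>\<^sub>\<infinity>x. \<Phi> x (\<lambda>y. u y + v y)) - (\<Sum>\<^sub>\<infinity>x. \<Phi> x u)"
  obtain t0 where t0: "0 < t0" "t0 \<le> 1" "\<And>t. 0 < t \<Longrightarrow> t \<le> t0 \<Longrightarrow>
    (\<Sum>\<^sub>\<infinity>x. \<psi> x (\<lambda>y. u y + t * v y)) - (\<Sum>\<^sub>\<infinity>x. \<psi> x u) \<le>
    (\<Sum>\<^sub>\<infinity>x. \<Phi> x (\<lambda>y. u y + t * v y)) - (\<Sum>\<^sub>\<infinity>x. \<Phi> x u)"
    using minimiser_perturb[OF u v(1)] by blast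
  have "(\<Sum>x\<in>A. (\<psi> x (\<lambda>y. u y + t * v y) - \<psi> x u) / t) \<le> D" if t: "0 < t" "t \<le> t0" and A: "finite A" for t A
  proof -
    have "(\<Sum>x\<in>A. \<psi> x (\<lambda>y. u y + t * v y) - \<psi> x u) \<le> (\<Sum>\<^sub>\<infinity>x. \<psi> x (\<lambda>y. u y + t * v y) - \<psi> x u)"
      using A t v by (intro finite_sum_le_infsum summable_on_diff_real \<psi>_summable duv du) (auto intro!: \<psi>_mono)
    also have "\<dots> \<le> (\<Sum>\<^sub>\<infinity>x. \<Phi> x (\<lambda>y. u y + t * v y)) - (\<Sum>\<^sub>\<infinity>x. \<Phi> x u)"
      using t0(3)[OF t] by (simp add: infsum_diff_real \<psi>_summable duv du)
    also have "\<dots> \<le> (\<Sum>\<^sub>\<infinity>x. (1 - t) * \<Phi> x u + t * \<Phi> x (\<lambda>y. u y + v y)) - (\<Sum>\<^sub>\<infinity>x. \<Phi> x u)"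
      using t t0(2) duv[of 1] du
      by (intro diff_right_mono infsum_mono duv summable_on_add summable_on_cmult_right
            convex_diffD(2)[OF \<Phi>_diff]) auto
    also have "(\<Sum>\<^sub>\<infinity>x. (1 - t) * \<Phi> x u + t * \<Phi> x (\<lambda>y. u y + v y)) =
        (1 - t) * (\<Sum>\<^sub>\<infinity>x. \<Phi> x u) + t * (\<Sum>\<^sub>\<infinity>x. \<Phi> x (\<lambda>y. u y + v y))"
      using duv[of 1] du
      by (subst infsum_add) (simp_all add: summable_on_cmult_right infsum_cmult_right')
    also have "\<dots> - (\<Sum>\<^sub>\<infinity>x. \<Phi> x u) = t * D"
      by (simp add: D_def algebra_simps)
    finally show ?thesis using t by (simp add: sum_divide_distrib[symmetric] field_simps)
  qed
  then show thesis using t0(1) that by blast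
qed

text \<open>If \<open>u z = 0\<close>, a point mass at \<open>z\<close> makes the quotient at
  \<open>z\<close> equal to a positive constant times \<open>t powr (- \<gamma>)\<close>, which no
  \<open>D\<close> bounds as \<open>t\<close> tends to 0.\<close>

lemma minimiser_pos:
  assumes u: "minimiser K u"
  shows "0 < u z"
proof (rule ccontr)
  assume "\<not> 0 < u z"
  then have uz: "u z = 0" using u by (auto simp: minimiser_def order.antisym)
  define c0 where "c0 = F z / (1 - \<gamma>)"
  have c0: "0 < c0" using F_pos \<gamma> by (simp add: c0_def)
  define e where "e = (\<lambda>y. if y = z then 1 else 0 :: real)"
  have e: "finite_energy e" "0 \<le> e x" for x
    using domain_delta[of z] by (auto simp: e_def)
  obtain t0 D where t0: "0 < t0" and D: "\<And>t A. 0 < t \<Longrightarrow> t \<le> t0 \<Longrightarrow> finite A \<Longrightarrow>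
    (\<Sum>x\<in>A. (\<psi> x (\<lambda>y. u y + t * e y) - \<psi> x u) / t) \<le> D"
    using minimiser_singular_bound[OF u e] by blast
  have "c0 \<le> t powr \<gamma> * D" if "0 < t" "t \<le> t0" for t
  proof -
    have "c0 * t powr (1 - \<gamma>) \<le> D * t"
    proof -
      have "c0 * t powr (1 - \<gamma>) / t \<le> D"
        using D[OF that, of "{z}"] uz that by (simp add: \<psi>_def c0_def e_def)
      then show ?thesis using that by (simp add: field_simps)
    qed
    then have "c0 * (t powr (1 - \<gamma>) * t powr \<gamma>) \<le> t powr \<gamma> * D * t"
      using mult_right_mono[of "c0 * t powr (1 - \<gamma>)" "D * t" "t powr \<gamma>"] by (simp add: mult_ac)
    moreover have "t powr (1 - \<gamma>) * t powr \<gamma> = t"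
      using that by (simp flip: powr_add)
    ultimately show ?thesis using that by simp
  qed
  then have "\<forall>\<^sub>F t in at_right 0. c0 \<le> t powr \<gamma> * D"
    using t0 unfolding eventually_at_right_field by (intro exI[of _ t0]) auto
  moreover have "((\<lambda>t::real. t powr \<gamma> * D) \<longlongrightarrow> 0 powr \<gamma> * D) (at_right 0)"
    using \<gamma> by (intro tendsto_intros tendsto_powr') (auto simp: eventually_at_right_field intro: exI[of _ 1])
  ultimately have "c0 \<le> 0 powr \<gamma> * D"
    by (intro tendsto_lowerbound) auto
  then show False using c0 \<gamma> by simp
qed

text \<open>A Fatou argument: the uniform bound on finite sums of quotients in direction
  \<open>\<bar>v\<bar>\<close> passes to the limit of \<open>t\<close> to 0.\<close>

lemma minimiser_singular_summable:
  assumes u: "minimiser K u" and v: "finite_energy v"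
  shows "(\<lambda>x. F x * u x powr (- \<gamma>) * \<bar>v x\<bar>) summable_on UNIV"
proof (rule nonneg_bdd_above_summable_on)
  obtain t0 D where t0: "0 < t0" and D: "\<And>t A. 0 < t \<Longrightarrow> t \<le> t0 \<Longrightarrow> finite A \<Longrightarrow>
    (\<Sum>x\<in>A. (\<psi> x (\<lambda>y. u y + t * \<bar>v y\<bar>) - \<psi> x u) / t) \<le> D"
    using minimiser_singular_bound[OF u finite_energy_abs[OF v] abs_ge_zero] by blast
  have "((\<lambda>t. (\<psi> x (\<lambda>y. u y + t * \<bar>v y\<bar>) - \<psi> x u) / t) \<longlongrightarrow> F x * u x powr (- \<gamma>) * \<bar>v x\<bar>) (at_right 0)" for x
    using \<psi>_deriv[of u x "\<lambda>y. \<bar>v y\<bar>", OF minimiser_pos[OF u]] unfolding has_field_derivative_iff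
    by (auto intro: tendsto_mono[OF at_le])
  then have lim: "((\<lambda>t. \<Sum>x\<in>A. (\<psi> x (\<lambda>y. u y + t * \<bar>v y\<bar>) - \<psi> x u) / t) \<longlongrightarrow>
      (\<Sum>x\<in>A. F x * u x powr (- \<gamma>) * \<bar>v x\<bar>)) (at_right 0)" for A
    by (intro tendsto_sum)
  have "\<forall>\<^sub>F t in at_right 0. (\<Sum>x\<in>A. (\<psi> x (\<lambda>y. u y + t * \<bar>v y\<bar>) - \<psi> x u) / t) \<le> D" if "finite A" for A
    using D[OF _ _ that] t0 unfolding eventually_at_right_field by (intro exI[of _ t0]) auto
  then have "(\<Sum>x\<in>A. F x * u x powr (- \<gamma>) * \<bar>v x\<bar>) \<le> D" if "finite A" for A
    using that by (intro tendsto_upperbound[OF lim]) auto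
  then show "bdd_above (sum (\<lambda>x. F x * u x powr (- \<gamma>) * \<bar>v x\<bar>) ` {A. A \<subseteq> UNIV \<and> finite A})"
    by (intro bdd_aboveI2[where M = D]) auto
qed (simp add: less_imp_le[OF F_pos])

lemma finite_energy_diff: "finite_energy u \<Longrightarrow> finite_energy v \<Longrightarrow> finite_energy (\<lambda>y. u y - v y)"
  using domain_linear[of u v "-1"] by simp

lemma finite_energy_add: "finite_energy u \<Longrightarrow> finite_energy v \<Longrightarrow> finite_energy (\<lambda>y. u y + v y)"
  using domain_linear[of u v 1] by simp

lemma minimiser_inequality:
  assumes u: "minimiser K u" and v: "finite_energy v"
  shows "0 \<le> (\<Sum>\<^sub>\<infinity>x. d\<Phi> x u v - F x * u x powr (- \<gamma>) * v x)"
proof -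
  have du: "finite_energy u" using u by (simp add: minimiser_def)
  have pos: "0 < u x" for x by (rule minimiser_pos[OF u])
  have duv: "finite_energy (\<lambda>y. u y + t * v y)" for t using domain_linear du v by blast
  obtain t0 where t0: "0 < t0" "t0 \<le> 1" "\<And>t. 0 < t \<Longrightarrow> t \<le> t0 \<Longrightarrow>
    (\<Sum>\<^sub>\<infinity>x. \<psi> x (\<lambda>y. u y + t * v y)) - (\<Sum>\<^sub>\<infinity>x. \<psi> x u) \<le>
    (\<Sum>\<^sub>\<infinity>x. \<Phi> x (\<lambda>y. u y + t * v y)) - (\<Sum>\<^sub>\<infinity>x. \<Phi> x u)"
    using minimiser_perturb[OF u v] by blast
  \<comment> \<open>The first two summands dominate the quotients of \<open>\<Phi>\<close>, the last
    one those of \<open>\<psi>\<close>.\<close>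
  define b where "b x = \<bar>\<Phi> x (\<lambda>y. u y + v y) - \<Phi> x u\<bar> + \<bar>\<Phi> x (\<lambda>y. u y - v y) - \<Phi> x u\<bar>
    + 1 / (1 - \<gamma>) * (F x * u x powr (- \<gamma>) * \<bar>v x\<bar>)" for x
  show ?thesis
  proof (rule infsum_right_derivative_nonneg[OF t0(1),
      where H = "\<lambda>x t. \<Phi> x (\<lambda>y. u y + t * v y) - \<psi> x (\<lambda>y. u y + t * v y)" and b = b])
    fix x
    show "((\<lambda>t. \<Phi> x (\<lambda>y. u y + t * v y) - \<psi> x (\<lambda>y. u y + t * v y)) has_real_derivative
        d\<Phi> x u v - F x * u x powr (- \<gamma>) * v x) (at 0)"
      by (intro DERIV_diff convex_diffD(4)[OF \<Phi>_diff] \<psi>_deriv pos)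
  next
    fix x and t :: real assume t: "0 < t" "t \<le> t0"
    have "\<bar>(\<Phi> x (\<lambda>y. u y + t * v y) - \<Phi> x u) / t\<bar>
        \<le> \<bar>\<Phi> x (\<lambda>y. u y + v y) - \<Phi> x u\<bar> + \<bar>\<Phi> x (\<lambda>y. u y - v y) - \<Phi> x u\<bar>"
      using t t0 by (intro convex_diff_quotient_abs_le[OF \<Phi>_diff]) auto
    moreover have "\<bar>(\<psi> x (\<lambda>y. u y + t * v y) - \<psi> x u) / t\<bar> \<le> 1 / (1 - \<gamma>) * (F x * u x powr (- \<gamma>) * \<bar>v x\<bar>)"
      using \<psi>_increment[of u x t v, OF pos] t by (simp add: field_simps)
    ultimately have "\<bar>(\<Phi> x (\<lambda>y. u y + t * v y) - \<Phi> x u) / t - (\<psi> x (\<lambda>y. u y + t * v y) - \<psi> x u) / t\<bar> \<le> b x"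
      unfolding b_def by linarith
    then show "\<bar>(\<Phi> x (\<lambda>y. u y + t * v y) - \<psi> x (\<lambda>y. u y + t * v y)
        - (\<Phi> x (\<lambda>y. u y + 0 * v y) - \<psi> x (\<lambda>y. u y + 0 * v y))) / t\<bar> \<le> b x"
      by (simp add: diff_divide_distrib)
  next
    show "b summable_on UNIV"
      unfolding b_def
      by (intro summable_on_add summable_on_abs_diff summable_on_cmult_right
          minimiser_singular_summable[OF u v] finite_energy_add finite_energy_diff du v)
  next
    fix t :: real assume "0 < t" "t \<le> t0"
    then show "0 \<le> (\<Sum>\<^sub>\<infinity>x. \<Phi> x (\<lambda>y. u y + t * v y) - \<psi> x (\<lambda>y. u y + t * v y)
        - (\<Phi> x (\<lambda>y. u y + 0 * v y) - \<psi> x (\<lambda>y. u y + 0 * v y)))"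
      using t0(3)[of t] by (simp add: infsum_diff_real summable_on_diff_real duv du \<psi>_summable)
  qed
qed

text \<open>The derivative is homogeneous in the direction, so the variational inequality for
  \<open>v\<close> and for \<open>-v\<close> together is the Euler-Lagrange equation.\<close>

theorem ex_singular_solution:
  obtains u where "finite_energy u" "\<And>x. 0 < u x"
    "\<And>v. finite_energy v \<Longrightarrow> (\<lambda>x. F x * u x powr (- \<gamma>) * v x) summable_on UNIV"
    "\<And>v. finite_energy v \<Longrightarrow> (\<Sum>\<^sub>\<infinity>x. d\<Phi> x u v) = (\<Sum>\<^sub>\<infinity>x. F x * u x powr (- \<gamma>) * v x)"
proof -
  obtain K u where u: "minimiser K u" using ex_minimiser by blast
  then have du: "finite_energy u" by (simp add: minimiser_def)
  have F: "(\<lambda>x. F x * u x powr (- \<gamma>) * v x) summable_on UNIV" if "finite_energy v" for v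
    by (rule summable_on_UNIV_dominated[OF minimiser_singular_summable[OF u that]])
       (simp add: abs_mult abs_of_pos[OF F_pos])
  have D: "(\<lambda>x. d\<Phi> x u v) summable_on UNIV" if "finite_energy v" for v
    by (rule summable_convex_diff[of \<Phi> d\<Phi> u v, OF \<Phi>_diff du finite_energy_add[OF du that] finite_energy_diff[OF du that]])
  have le: "(\<Sum>\<^sub>\<infinity>x. F x * u x powr (- \<gamma>) * v x) \<le> (\<Sum>\<^sub>\<infinity>x. d\<Phi> x u v)" if "finite_energy v" for v
    using minimiser_inequality[OF u that] by (simp add: infsum_diff_real D F that)
  have "(\<Sum>\<^sub>\<infinity>x. d\<Phi> x u v) \<le> (\<Sum>\<^sub>\<infinity>x. F x * u x powr (- \<gamma>) * v x)" if v: "finite_energy v" for v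
  proof -
    have "\<Phi> x (\<lambda>y. - v y) \<le> \<Phi> x v" for x by (rule \<Phi>_contraction) auto
    then have "finite_energy (\<lambda>y. - v y)"
      by (intro summable_on_UNIV_dominated[OF v]) (use \<Phi>_nonneg in auto)
    moreover have "d\<Phi> x u (\<lambda>y. - v y) = - d\<Phi> x u v" for x
      using convex_diffD(3)[OF \<Phi>_diff, of x u "-1" v] by simp
    ultimately have "(\<Sum>\<^sub>\<infinity>x. - (F x * u x powr (- \<gamma>) * v x)) \<le> (\<Sum>\<^sub>\<infinity>x. - d\<Phi> x u v)"
      using le[of "\<lambda>y. - v y"] by simp
    then show ?thesis
      unfolding infsum_uminus by simp
  qed
  then have eq: "(\<Sum>\<^sub>\<infinity>x. d\<Phi> x u v) = (\<Sum>\<^sub>\<infinity>x. F x * u x powr (- \<gamma>) * v x)" if "finite_energy v" for v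
    using le that by (intro order.antisym)
  show thesis
    by (rule that[OF du minimiser_pos[OF u] F eq])
qed

end

subsection \<open>The graph energies\<close>

text \<open>Here the seminorm is \<open>\<bar>u x\<bar>\<close>, so the zeroth-order terms are
  instances of the estimates for forms.\<close>

interpretation value_form: psd_form "\<lambda>u v. u x * v x" for x :: 'v
  by unfold_locales (auto simp: algebra_simps)

lemma value_form_N [simp]: "value_form.N x u = \<bar>u x\<bar>"
  by (simp add: value_form.N_def)

lemma powr_diff_mult_diff_nonneg:
  fixes u v r :: real
  assumes "0 < u" "0 < v" "0 < r"
  shows "0 \<le> (u powr r - v powr r) * (u - v)" "u \<noteq> v \<Longrightarrow> 0 < (u powr r - v powr r) * (u - v)"
    "(u powr (- r) - v powr (- r)) * (u - v) \<le> 0"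
proof -
  have *: "x powr r < y powr r" "y powr (- r) < x powr (- r)" if "0 < x" "x < y" for x y :: real
    using that assms by (auto intro: powr_less_mono2 powr_less_mono2_neg)
  show 1: "u \<noteq> v \<Longrightarrow> 0 < (u powr r - v powr r) * (u - v)"
    using *[of u v] *[of v u] assms by (cases u v rule: linorder_cases) (auto intro: mult_neg_neg)
  show "0 \<le> (u powr r - v powr r) * (u - v)"
    using 1 by (cases "u = v") auto
  show "(u powr (- r) - v powr (- r)) * (u - v) \<le> 0"
    using *[of u v] *[of v u] assms
    by (cases u v rule: linorder_cases) (auto intro: mult_nonneg_nonpos mult_nonpos_nonneg)
qed

context weighted_graph
begin

lemma psd_form_grad: "psd_form (\<lambda>u v. grad_form E \<omega> \<mu> u v x)"
proof
  fix u v w :: "'v \<Rightarrow> real" and c :: real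
  show "grad_form E \<omega> \<mu> u (\<lambda>x. v x + w x) x = grad_form E \<omega> \<mu> u v x + grad_form E \<omega> \<mu> u w x"
    by (simp add: grad_form_def algebra_simps sum.distrib sum_subtractf add_divide_distrib diff_divide_distrib)
  show "grad_form E \<omega> \<mu> u (\<lambda>x. c * v x) x = c * grad_form E \<omega> \<mu> u v x"
    by (simp add: grad_form_def sum_distrib_left algebra_simps)
  show "grad_form E \<omega> \<mu> u v x = grad_form E \<omega> \<mu> v u x"
    by (simp add: grad_form_def mult_ac)
  have "0 \<le> \<omega> x y * (u y - u x) * (u y - u x)" if "y \<in> E `` {x}" for y
    using weight_pos[of x y] that by (simp add: mult.assoc)
  then show "0 \<le> grad_form E \<omega> \<mu> u u x"
    using measure_pos[of x] by (auto simp: grad_form_def intro!: divide_nonneg_pos sum_nonneg)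
qed

interpretation grad: psd_form "\<lambda>u v. grad_form E \<omega> \<mu> u v x" for x
  by (rule psd_form_grad)

lemma grad_N [simp]: "grad.N x u = grad_norm E \<omega> \<mu> u x"
  by (simp add: grad.N_def grad_norm_def)

definition energy :: "('v \<Rightarrow> real) \<Rightarrow> real \<Rightarrow> 'v \<Rightarrow> ('v \<Rightarrow> real) \<Rightarrow> real" where
  "energy a s x u = grad_norm E \<omega> \<mu> u x powr s / s + a x * (\<bar>u x\<bar> powr s / s)"

text \<open>The zeroth-order term is written with \<open>\<bar>u x\<bar> powr (s - 2) * u x\<close>
  to suit functions of either sign; where \<open>u x > 0\<close> this is
  \<open>u x powr (s - 1)\<close>.\<close>

definition energy_deriv :: "('v \<Rightarrow> real) \<Rightarrow> real \<Rightarrow> 'v \<Rightarrow> ('v \<Rightarrow> real) \<Rightarrow> ('v \<Rightarrow> real) \<Rightarrow> real" where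
  "energy_deriv a s x u v =
    grad_norm E \<omega> \<mu> u x powr (s - 2) * grad_form E \<omega> \<mu> u v x + a x * (\<bar>u x\<bar> powr (s - 2) * (u x * v x))"

lemma energy_convex_diff:
  assumes "1 < s" "0 \<le> a x"
  shows "convex_diff (energy a s x) (energy_deriv a s x)"
  using convex_diff_add[OF grad.convex_diff_powr[OF assms(1), of x]
    convex_diff_scale[OF value_form.convex_diff_powr[OF assms(1), of x] assms(2)]]
  by (simp add: energy_def[abs_def] energy_deriv_def[abs_def])

lemma energy_deriv_pos: "0 < u x \<Longrightarrow> energy_deriv a s x u v = weak_integrand E \<omega> \<mu> a s u v x"
  by (simp add: energy_deriv_def weak_integrand_def powr_diff power2_eq_square field_simps)

lemma energy_nonneg: "1 < s \<Longrightarrow> 0 \<le> a x \<Longrightarrow> 0 \<le> energy a s x u"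
  by (simp add: energy_def)

lemma energy_coercive: "1 < s \<Longrightarrow> a x / s * \<bar>u x\<bar> powr s \<le> energy a s x u"
  by (simp add: energy_def)

lemma energy_scale: "energy a s x (\<lambda>y. t * u y) = \<bar>t\<bar> powr s * energy a s x u"
  using grad.N_scale[of x t u] by (simp add: energy_def powr_mult abs_mult grad_norm_def distrib_left)

text \<open>\<open>u + v\<close> is the midpoint of \<open>2 u\<close> and \<open>2 v\<close>;
  convexity and homogeneity of degree \<open>s\<close> do the rest.\<close>

lemma energy_add_le:
  assumes "1 < s" "0 \<le> a x"
  shows "energy a s x (\<lambda>y. u y + v y) \<le> 2 powr s * (energy a s x u + energy a s x v)"
proof -
  have mid: "(\<lambda>y. 2 * u y + 1 / 2 * (2 * v y - 2 * u y)) = (\<lambda>y. u y + v y)"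
    and end_pt: "(\<lambda>y. 2 * u y + (2 * v y - 2 * u y)) = (\<lambda>y. 2 * v y)"
    by (auto simp: field_simps)
  have "energy a s x (\<lambda>y. 2 * u y + 1 / 2 * (2 * v y - 2 * u y))
      \<le> (1 - 1 / 2) * energy a s x (\<lambda>y. 2 * u y) + 1 / 2 * energy a s x (\<lambda>y. 2 * u y + (2 * v y - 2 * u y))"
    by (rule convex_diffD(2)[OF energy_convex_diff[of s a x, OF assms]]) auto
  then have "energy a s x (\<lambda>y. u y + v y) \<le> 1 / 2 * (2 powr s * (energy a s x u + energy a s x v))"
    unfolding mid end_pt energy_scale by (simp add: algebra_simps)
  moreover have "0 \<le> 2 powr s * (energy a s x u + energy a s x v)"
    using assms energy_nonneg by (intro mult_nonneg_nonneg add_nonneg_nonneg) auto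
  ultimately show ?thesis by linarith
qed

lemma energy_zero: "energy a s x (\<lambda>_. 0) = 0"
  by (simp add: energy_def grad_norm_def grad_form_def)

lemma energy_contraction:
  assumes "1 < s" "0 \<le> a x" and "\<And>y. \<bar>v y\<bar> \<le> \<bar>u y\<bar>" "\<And>y z. \<bar>v y - v z\<bar> \<le> \<bar>u y - u z\<bar>"
  shows "energy a s x v \<le> energy a s x u"
proof -
  have "grad_form E \<omega> \<mu> v v x \<le> grad_form E \<omega> \<mu> u u x"
    unfolding grad_form_def mult.assoc power2_eq_square[symmetric]
    using measure_pos[of x] weight_pos assms(4)
    by (intro mult_left_mono sum_mono) (auto simp: abs_le_square_iff less_imp_le)
  then have "grad_norm E \<omega> \<mu> v x \<le> grad_norm E \<omega> \<mu> u x"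
    by (simp add: grad_norm_def)
  then show ?thesis
    unfolding energy_def using assms grad.N_nonneg[of x v]
    by (intro add_mono mult_left_mono divide_right_mono powr_mono2) auto
qed

lemma energy_continuous:
  assumes "1 < s"
  shows "continuous_on UNIV (energy a s x)"
proof -
  have "continuous_on UNIV (\<lambda>u. grad_form E \<omega> \<mu> u u x)"
    unfolding grad_form_def using measure_pos[of x] by (intro continuous_intros) auto
  then have "continuous_on UNIV (\<lambda>u. grad_norm E \<omega> \<mu> u x)"
    unfolding grad_norm_def by (intro continuous_on_real_sqrt)
  then show ?thesis
    unfolding energy_def[abs_def] using assms grad.N_nonneg[of x]
    by (intro continuous_intros continuous_on_powr') auto
qed

text \<open>A point mass has energy only at its vertex and the neighbours, and these are finitely
  many; symmetry of \<open>E\<close> identifies the vertices that see \<open>z\<close> with the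
  neighbours of \<open>z\<close>.\<close>

lemma energy_delta_summable: "(\<lambda>x. \<mu> x * energy a s x (\<lambda>y. if y = z then 1 else 0)) summable_on UNIV"
proof -
  have "energy a s x (\<lambda>y. if y = z then 1 else 0) = 0" if "x \<notin> {z} \<union> E `` {z}" for x
  proof -
    have "y \<noteq> z" if "(x, y) \<in> E" for y
      using that \<open>x \<notin> _\<close> edges_sym by (auto dest: symD)
    then have "grad_form E \<omega> \<mu> (\<lambda>y. if y = z then 1 else 0) (\<lambda>y. if y = z then 1 else 0) x = 0"
      using that by (auto simp: grad_form_def intro!: sum.neutral)
    then show ?thesis using that by (simp add: energy_def grad_norm_def)
  qed
  then have "{x \<in> UNIV. \<mu> x * energy a s x (\<lambda>y. if y = z then 1 else 0) \<noteq> 0} \<subseteq> {z} \<union> E `` {z}"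
    by auto
  then show ?thesis
    using locally_finite by (intro finite_nonzero_values_imp_summable_on) (auto intro: finite_subset)
qed

section \<open>Weighted Sobolev spaces as finite-energy spaces\<close>

lemma W1_weighted_iff_energy:
  assumes "1 < s" "0 < a0" "\<And>x. a0 \<le> a x"
  shows "u \<in> W1_weighted E \<omega> \<mu> a s \<longleftrightarrow> (\<lambda>x. \<mu> x * energy a s x u) summable_on UNIV"
proof
  assume "u \<in> W1_weighted E \<omega> \<mu> a s"
  then have "(\<lambda>x. \<mu> x * (grad_norm E \<omega> \<mu> u x powr s + \<bar>u x\<bar> powr s) + \<mu> x * (a x * \<bar>u x\<bar> powr s)) summable_on UNIV"
    by (auto simp: W1_weighted_def W1_def V_integrable_def intro!: summable_on_add)
  then show "(\<lambda>x. \<mu> x * energy a s x u) summable_on UNIV"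
  proof (rule summable_on_UNIV_dominated)
    fix x
    have "0 \<le> a x" using assms(2) assms(3)[of x] by simp
    then have *: "0 \<le> energy a s x u" using assms by (intro energy_nonneg)
    have "energy a s x u = (grad_norm E \<omega> \<mu> u x powr s + a x * \<bar>u x\<bar> powr s) / s"
      by (simp add: energy_def add_divide_distrib)
    also have "\<dots> \<le> (grad_norm E \<omega> \<mu> u x powr s + a x * \<bar>u x\<bar> powr s) / 1"
      using assms(1) \<open>0 \<le> a x\<close> by (intro divide_left_mono) auto
    also have "\<dots> \<le> (grad_norm E \<omega> \<mu> u x powr s + \<bar>u x\<bar> powr s) + a x * \<bar>u x\<bar> powr s"
      by simp
    finally have "\<mu> x * energy a s x u \<le> \<mu> x * ((grad_norm E \<omega> \<mu> u x powr s + \<bar>u x\<bar> powr s) + a x * \<bar>u x\<bar> powr s)"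
      using measure_pos[of x] by (intro mult_left_mono) auto
    then show "\<bar>\<mu> x * energy a s x u\<bar> \<le> \<mu> x * (grad_norm E \<omega> \<mu> u x powr s + \<bar>u x\<bar> powr s) + \<mu> x * (a x * \<bar>u x\<bar> powr s)"
      using * measure_pos[of x] by (simp add: distrib_left)
  qed
next
  assume sm: "(\<lambda>x. \<mu> x * energy a s x u) summable_on UNIV"
  have a: "0 \<le> a x" for x using assms(2) assms(3)[of x] by simp
  have e: "s * energy a s x u = grad_norm E \<omega> \<mu> u x powr s + a x * \<bar>u x\<bar> powr s" for x
    using assms(1) by (simp add: energy_def distrib_left)
  \<comment> \<open>The lower bound \<open>a0\<close> lets the weighted term control the unweighted
    one, so finite energy yields both integrability conditions.\<close>
  have a1: "\<bar>u x\<bar> powr s \<le> a x * \<bar>u x\<bar> powr s / a0" for x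
    using assms(2) assms(3)[of x] mult_right_mono[of a0 "a x" "\<bar>u x\<bar> powr s"] by (simp add: field_simps)
  have "V_integrable \<mu> (\<lambda>x. grad_norm E \<omega> \<mu> u x powr s + \<bar>u x\<bar> powr s)"
    unfolding V_integrable_def
  proof (rule summable_on_UNIV_dominated[OF summable_on_cmult_left[OF sm, of "s * (1 + 1 / a0)"]])
    fix x
    have "grad_norm E \<omega> \<mu> u x powr s + \<bar>u x\<bar> powr s \<le> s * energy a s x u + s * energy a s x u / a0"
    proof -
      have "0 \<le> grad_norm E \<omega> \<mu> u x powr s / a0" "0 \<le> a x * \<bar>u x\<bar> powr s"
        using a[of x] assms(2) by auto
      then show ?thesis
        unfolding e add_divide_distrib using a1[of x] by linarith
    qed
    then have "\<mu> x * (grad_norm E \<omega> \<mu> u x powr s + \<bar>u x\<bar> powr s) \<le> \<mu> x * (s * energy a s x u + s * energy a s x u / a0)"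
      using measure_pos[of x] by (intro mult_left_mono) auto
    then show "\<bar>\<mu> x * (grad_norm E \<omega> \<mu> u x powr s + \<bar>u x\<bar> powr s)\<bar> \<le> \<mu> x * energy a s x u * (s * (1 + 1 / a0))"
      using measure_pos[of x] by (simp add: algebra_simps abs_mult)
  qed
  moreover have "V_integrable \<mu> (\<lambda>x. a x * \<bar>u x\<bar> powr s)"
    unfolding V_integrable_def
  proof (rule summable_on_UNIV_dominated[OF summable_on_cmult_left[OF sm, of s]])
    fix x
    have "a x * \<bar>u x\<bar> powr s \<le> s * energy a s x u" unfolding e by simp
    then have "\<mu> x * (a x * \<bar>u x\<bar> powr s) \<le> \<mu> x * (s * energy a s x u)"
      using measure_pos[of x] by (intro mult_left_mono) auto
    then show "\<bar>\<mu> x * (a x * \<bar>u x\<bar> powr s)\<bar> \<le> \<mu> x * energy a s x u * s"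
      using measure_pos[of x] a[of x] by (simp add: mult_ac abs_mult)
  qed
  ultimately show "u \<in> W1_weighted E \<omega> \<mu> a s"
    by (simp add: W1_weighted_def W1_def)
qed

lemma W1_weighted_linear:
  assumes "1 < s" "0 < a0" "\<And>x. a0 \<le> a x"
    and "u \<in> W1_weighted E \<omega> \<mu> a s" "v \<in> W1_weighted E \<omega> \<mu> a s"
  shows "(\<lambda>x. u x + t * v x) \<in> W1_weighted E \<omega> \<mu> a s"
proof -
  have a: "0 \<le> a x" for x using assms(2) assms(3)[of x] by simp
  have "(\<lambda>x. 2 powr s * (\<mu> x * energy a s x u + \<bar>t\<bar> powr s * (\<mu> x * energy a s x v))) summable_on UNIV"
    using assms(4,5) unfolding W1_weighted_iff_energy[OF assms(1-3)]
    by (intro summable_on_cmult_right summable_on_add)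
  then have "(\<lambda>x. \<mu> x * energy a s x (\<lambda>x. u x + t * v x)) summable_on UNIV"
  proof (rule summable_on_UNIV_dominated)
    fix x
    have "\<mu> x * energy a s x (\<lambda>y. u y + t * v y) \<le> \<mu> x * (2 powr s * (energy a s x u + energy a s x (\<lambda>y. t * v y)))"
      using energy_add_le[of s a x u "\<lambda>y. t * v y", OF assms(1) a] measure_pos[of x]
      by (intro mult_left_mono) auto
    then show "\<bar>\<mu> x * energy a s x (\<lambda>x. u x + t * v x)\<bar>
        \<le> 2 powr s * (\<mu> x * energy a s x u + \<bar>t\<bar> powr s * (\<mu> x * energy a s x v))"
      using measure_pos[of x] energy_nonneg[of s a x, OF assms(1) a] by (simp add: energy_scale algebra_simps)
  qed
  then show ?thesis unfolding W1_weighted_iff_energy[OF assms(1-3)] .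
qed

text \<open>With the measure bounded below, a value \<open>u x\<close> costs at least
  \<open>\<mu>0 * (a0 / s) * \<bar>u x\<bar> powr s\<close> of the total energy.\<close>

lemma W1_weighted_bounded:
  assumes "1 < s" "0 < a0" "\<And>x. a0 \<le> a x" "0 < \<mu>0" "\<And>x. \<mu>0 \<le> \<mu> x"
    and "u \<in> W1_weighted E \<omega> \<mu> a s"
  obtains M where "1 \<le> M" "\<And>x. \<bar>u x\<bar> \<le> M"
proof (rule summable_coercive_bounded)
  show "(\<lambda>x. \<mu> x * energy a s x u) summable_on UNIV"
    using assms(6) unfolding W1_weighted_iff_energy[OF assms(1-3)] .
  show "\<mu>0 * (a0 / s) * \<bar>u x\<bar> powr s \<le> \<mu> x * energy a s x u" for x
  proof -
    have "a0 / s * \<bar>u x\<bar> powr s \<le> a x / s * \<bar>u x\<bar> powr s"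
      using assms by (intro mult_right_mono divide_right_mono) auto
    also have "\<dots> \<le> energy a s x u" by (rule energy_coercive[OF assms(1)])
    finally have "\<mu>0 * (a0 / s * \<bar>u x\<bar> powr s) \<le> \<mu> x * energy a s x u"
      using assms measure_pos[of x] by (intro mult_mono) auto
    then show ?thesis by (simp only: mult.assoc)
  qed
qed (use assms that in auto)


subsection \<open>Existence and uniqueness\<close>

text \<open>The gradient part is monotone as a subgradient; strictness comes from the zeroth-order
  part, where \<open>a x > 0\<close>.\<close>

lemma weak_integrand_monotone:
  fixes u v :: "'v \<Rightarrow> real"
  assumes "1 < s" "0 < a x" "0 < u x" "0 < v x"
  defines "w \<equiv> \<lambda>y. u y - v y"
  shows "weak_integrand E \<omega> \<mu> a s v w x \<le> weak_integrand E \<omega> \<mu> a s u w x"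
    and "u x \<noteq> v x \<Longrightarrow> weak_integrand E \<omega> \<mu> a s v w x < weak_integrand E \<omega> \<mu> a s u w x"
proof -
  define G where "G = grad_norm E \<omega> \<mu> u x powr (s - 2) * grad_form E \<omega> \<mu> u w x -
    grad_norm E \<omega> \<mu> v x powr (s - 2) * grad_form E \<omega> \<mu> v w x"
  have G: "0 \<le> G"
    unfolding G_def w_def using grad.monotone[OF assms(1), of x u v] by simp
  have eq: "weak_integrand E \<omega> \<mu> a s u w x - weak_integrand E \<omega> \<mu> a s v w x =
      G + a x * ((u x powr (s - 1) - v x powr (s - 1)) * (u x - v x))"
    by (simp add: weak_integrand_def G_def w_def algebra_simps)
  have "0 \<le> a x * ((u x powr (s - 1) - v x powr (s - 1)) * (u x - v x))"
    using assms by (intro mult_nonneg_nonneg[of "a x"] powr_diff_mult_diff_nonneg) auto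
  then show "weak_integrand E \<omega> \<mu> a s v w x \<le> weak_integrand E \<omega> \<mu> a s u w x"
    using eq G by linarith
  assume "u x \<noteq> v x"
  then have "0 < a x * ((u x powr (s - 1) - v x powr (s - 1)) * (u x - v x))"
    using assms by (intro mult_pos_pos[of "a x"] powr_diff_mult_diff_nonneg) auto
  then show "weak_integrand E \<omega> \<mu> a s v w x < weak_integrand E \<omega> \<mu> a s u w x"
    using eq G by linarith
qed

lemma positive_solution_unique:
  fixes f g a b :: "'v \<Rightarrow> real"
  assumes exps: "0 < \<gamma>" "1 < q" "1 < p" "0 < \<alpha>" and lam: "lam < 0"
    and f: "\<And>x. 0 < f x" and g: "\<And>x. 0 \<le> g x"
    and a: "0 < a0" "\<And>x. a0 \<le> a x" and b: "0 < b0" "\<And>x. b0 \<le> b x"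
    and u: "positive_solution E \<omega> \<mu> p q \<gamma> \<alpha> lam a b f g u"
    and v: "positive_solution E \<omega> \<mu> p q \<gamma> \<alpha> lam a b f g v"
  shows "u = v"
proof
  fix z
  define W where "W = W1_weighted E \<omega> \<mu> a p \<inter> W1_weighted E \<omega> \<mu> b q"
  define w where "w = (\<lambda>x. u x - v x)"
  have uv: "u \<in> W" "v \<in> W" "0 < u x" "0 < v x" for x
    using u v by (auto simp: positive_solution_def Let_def W_def)
  have w: "w \<in> W"
    using uv W1_weighted_linear[of p a0 a u v "-1", OF exps(3) a] W1_weighted_linear[of q b0 b u v "-1", OF exps(2) b]
    by (simp add: W_def w_def)
  have ab: "0 < a x" "0 < b x" for x
    using a b by (auto intro: less_le_trans)
  \<comment> \<open>The residual density at \<open>h\<close> of the equation tested with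
    \<open>w\<close>; it sums to 0 for every positive solution \<open>h\<close>.\<close>
  define R where "R h x = \<mu> x * weak_integrand E \<omega> \<mu> a p h w x + \<mu> x * weak_integrand E \<omega> \<mu> b q h w x
    - \<mu> x * (f x * h x powr (- \<gamma>) * w x) - lam * (\<mu> x * (g x * h x powr \<alpha> * w x))" for h x
  have R: "R h summable_on UNIV" "infsum (R h) UNIV = 0"
    if "positive_solution E \<omega> \<mu> p q \<gamma> \<alpha> lam a b f g h" for h
  proof -
    have *: "(\<lambda>x. \<mu> x * weak_integrand E \<omega> \<mu> a p h w x) summable_on UNIV"
      "(\<lambda>x. \<mu> x * weak_integrand E \<omega> \<mu> b q h w x) summable_on UNIV"
      "(\<lambda>x. \<mu> x * (f x * h x powr (- \<gamma>) * w x)) summable_on UNIV"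
      "(\<lambda>x. \<mu> x * (g x * h x powr \<alpha> * w x)) summable_on UNIV"
      and **: "(\<Sum>\<^sub>\<infinity>x. \<mu> x * weak_integrand E \<omega> \<mu> a p h w x) + (\<Sum>\<^sub>\<infinity>x. \<mu> x * weak_integrand E \<omega> \<mu> b q h w x)
        = (\<Sum>\<^sub>\<infinity>x. \<mu> x * (f x * h x powr (- \<gamma>) * w x)) + lam * (\<Sum>\<^sub>\<infinity>x. \<mu> x * (g x * h x powr \<alpha> * w x))"
      using that w unfolding positive_solution_def Let_def W_def V_integrable_def V_integral_def by blast+
    show "R h summable_on UNIV"
      unfolding R_def by (intro summable_on_diff_real summable_on_add summable_on_cmult_right *)
    have "infsum (R h) UNIV = (\<Sum>\<^sub>\<infinity>x. \<mu> x * weak_integrand E \<omega> \<mu> a p h w x)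
        + (\<Sum>\<^sub>\<infinity>x. \<mu> x * weak_integrand E \<omega> \<mu> b q h w x)
        - (\<Sum>\<^sub>\<infinity>x. \<mu> x * (f x * h x powr (- \<gamma>) * w x)) - lam * (\<Sum>\<^sub>\<infinity>x. \<mu> x * (g x * h x powr \<alpha> * w x))"
      unfolding R_def
      by (simp add: infsum_diff_real infsum_add summable_on_diff_real summable_on_add summable_on_cmult_right
          infsum_cmult_right' *)
    then show "infsum (R h) UNIV = 0" using ** by simp
  qed
  \<comment> \<open>\<open>A\<close> collects the left-hand side and \<open>S\<close> the right-hand
    side; \<open>S\<close> is nonnegative because negative powers decrease and
    \<open>lam < 0\<close>. A nonnegative family with sum 0 vanishes at every vertex, in particular
    at \<open>z\<close>.\<close>
  define A where "A x = (weak_integrand E \<omega> \<mu> a p u w x - weak_integrand E \<omega> \<mu> a p v w x)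
    + (weak_integrand E \<omega> \<mu> b q u w x - weak_integrand E \<omega> \<mu> b q v w x)" for x
  define S where "S x = - f x * ((u x powr (- \<gamma>) - v x powr (- \<gamma>)) * (u x - v x))
    + (- lam) * g x * ((u x powr \<alpha> - v x powr \<alpha>) * (u x - v x))" for x
  have RS: "R u x - R v x = \<mu> x * (A x + S x)" for x
    by (simp add: R_def A_def S_def w_def algebra_simps)
  have S: "0 \<le> S x" for x
    unfolding S_def using f[of x] g[of x] lam uv exps
    by (intro add_nonneg_nonneg mult_nonneg_nonneg mult_nonpos_nonpos powr_diff_mult_diff_nonneg) auto
  have A: "0 \<le> A x" "u x \<noteq> v x \<Longrightarrow> 0 < A x" for x
    unfolding A_def w_def using exps ab uv
      weak_integrand_monotone(1)[where s = p and a = a and x = x and u = u and v = v]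
      weak_integrand_monotone(2)[where s = p and a = a and x = x and u = u and v = v]
      weak_integrand_monotone(1)[where s = q and a = b and x = x and u = u and v = v]
    by (smt (verit))+
  have "R u z - R v z = 0"
  proof (rule nonneg_infsum_le_0D[of "\<lambda>x. R u x - R v x" UNIV])
    show "(\<Sum>\<^sub>\<infinity>x. R u x - R v x) \<le> 0"
      using R[OF u] R[OF v] by (simp add: infsum_diff_real)
    show "0 \<le> R u x - R v x" for x
      unfolding RS using A(1)[of x] S[of x] measure_pos[of x] by simp
  qed (use R u v in \<open>auto intro: summable_on_diff_real\<close>)
  then have "A z + S z = 0"
    unfolding RS using measure_pos[of z] by simp
  then show "u z = v z"
    using A(2)[of z] S[of z] by linarith
qed

section \<open>Existence as an instance of the abstract problem\<close>

lemma ex_positive_solution: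
  fixes f g a b :: "'v \<Rightarrow> real"
  assumes \<mu>0: "0 < \<mu>0" "\<And>x. \<mu>0 \<le> \<mu> x"
    and exps: "0 < \<gamma>" "\<gamma> < 1" "1 < q" "1 < p" "0 < \<alpha>" and lam: "lam < 0"
    and f: "\<And>x. 0 < f x" "f \<in> Lspace \<mu> 1" and g: "\<And>x. 0 \<le> g x" "g \<in> Lspace \<mu> 1"
    and a: "0 < a0" "\<And>x. a0 \<le> a x" and b: "0 < b0" "\<And>x. b0 \<le> b x"
  shows "\<exists>u. positive_solution E \<omega> \<mu> p q \<gamma> \<alpha> lam a b f g u"
proof -
  define W where "W = W1_weighted E \<omega> \<mu> a p \<inter> W1_weighted E \<omega> \<mu> b q"
  have ab: "0 \<le> a x" "0 \<le> b x" for x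
    using a(1) a(2)[of x] b(1) b(2)[of x] by linarith+
  have \<mu>: "0 \<le> \<mu> x" for x using measure_pos[of x] by simp
  have g_summable: "(\<lambda>x. \<mu> x * g x * h x) summable_on UNIV" if h: "\<And>x. \<bar>h x\<bar> \<le> M" for h M
  proof (rule summable_on_UNIV_dominated)
    show "(\<lambda>x. \<mu> x * g x * M) summable_on UNIV"
      using g by (intro summable_on_cmult_left) (simp add: Lspace_def V_integrable_def)
    show "\<bar>\<mu> x * g x * h x\<bar> \<le> \<mu> x * g x * M" for x
      using mult_left_mono[OF h, of "\<mu> x * g x" x] \<mu>[of x] g(1)[of x] by (simp add: abs_mult)
  qed
  \<comment> \<open>As \<open>lam < 0\<close> and \<open>g \<ge> 0\<close>, the \<open>g\<close>
    term is convex and nonnegative and joins the convex part; the singular term stays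
    outside.\<close>
  define P where "P x u = energy a p x u + energy b q x u - lam * g x * (\<bar>u x\<bar> powr (\<alpha> + 1) / (\<alpha> + 1))" for x u
  define \<Phi> where "\<Phi> x u = \<mu> x * P x u" for x u
  define d\<Phi> where "d\<Phi> x u v = \<mu> x * (energy_deriv a p x u v + energy_deriv b q x u v
    + (- lam * g x) * (\<bar>u x\<bar> powr (\<alpha> - 1) * (u x * v x)))" for x u v
  have lg: "0 \<le> - lam * g x" for x using lam g(1)[of x] by (simp add: mult_nonpos_nonneg)
  have term_nonneg: "0 \<le> energy a p x u" "0 \<le> energy b q x u"
    "0 \<le> - lam * g x * (\<bar>u x\<bar> powr (\<alpha> + 1) / (\<alpha> + 1))" for x u
    using exps ab by (intro energy_nonneg mult_nonneg_nonneg[OF lg] divide_nonneg_pos; simp)+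
  have P_eq: "P x u = energy a p x u + energy b q x u + (- lam * g x) * (\<bar>u x\<bar> powr (\<alpha> + 1) / (\<alpha> + 1))" for x u
    by (simp add: P_def)
  \<comment> \<open>Functions in \<open>W\<close> are bounded and \<open>g\<close> is integrable, so
    the \<open>g\<close> term is finite on \<open>W\<close> and the abstract domain is exactly
    \<open>W\<close>.\<close>
  have in_W: "u \<in> W \<longleftrightarrow> (\<lambda>x. \<Phi> x u) summable_on UNIV" for u
  proof
    assume u: "u \<in> W"
    obtain M where M: "1 \<le> M" "\<And>x. \<bar>u x\<bar> \<le> M"
      using W1_weighted_bounded[of p a0 a \<mu>0 u, OF exps(4) a \<mu>0] u unfolding W_def by blast
    have "(\<lambda>x. \<mu> x * g x * \<bar>u x\<bar> powr (\<alpha> + 1)) summable_on UNIV"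
      using M exps by (intro g_summable[of _ "M powr (\<alpha> + 1)"]) (auto intro!: powr_mono2)
    then have "(\<lambda>x. - lam / (\<alpha> + 1) * (\<mu> x * g x * \<bar>u x\<bar> powr (\<alpha> + 1))) summable_on UNIV"
      by (rule summable_on_cmult_right)
    moreover have "(\<lambda>x. \<mu> x * energy a p x u) summable_on UNIV" "(\<lambda>x. \<mu> x * energy b q x u) summable_on UNIV"
      using u W1_weighted_iff_energy[of p a0 a, OF exps(4) a] W1_weighted_iff_energy[of q b0 b, OF exps(3) b] by (auto simp: W_def)
    ultimately have "(\<lambda>x. \<mu> x * energy a p x u + \<mu> x * energy b q x u
        + - lam / (\<alpha> + 1) * (\<mu> x * g x * \<bar>u x\<bar> powr (\<alpha> + 1))) summable_on UNIV"
      by (intro summable_on_add)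
    then show "(\<lambda>x. \<Phi> x u) summable_on UNIV"
      by (simp add: \<Phi>_def P_def algebra_simps)
  next
    assume sm: "(\<lambda>x. \<Phi> x u) summable_on UNIV"
    have "\<mu> x * energy a p x u \<le> \<Phi> x u" "\<mu> x * energy b q x u \<le> \<Phi> x u" for x
      unfolding \<Phi>_def P_eq using term_nonneg[of x u] \<mu>[of x] by (auto intro!: mult_left_mono)
    then have "(\<lambda>x. \<mu> x * energy a p x u) summable_on UNIV" "(\<lambda>x. \<mu> x * energy b q x u) summable_on UNIV"
      using term_nonneg \<mu> by (auto intro!: summable_on_UNIV_dominated[OF sm])
    then show "u \<in> W"
      using W1_weighted_iff_energy[of p a0 a, OF exps(4) a] W1_weighted_iff_energy[of q b0 b, OF exps(3) b] by (auto simp: W_def)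
  qed
  interpret sv: singular_variational \<Phi> d\<Phi> "\<lambda>x. \<mu> x * f x" \<gamma> "\<mu>0 * (a0 / p)" p
  proof
    show "0 < \<gamma>" "\<gamma> < 1" "0 < \<mu>0 * (a0 / p)" "1 < p"
      using exps a \<mu>0 by auto
    show "0 < \<mu> x * f x" for x
      using f measure_pos by simp
    show "(\<lambda>x. \<mu> x * f x) summable_on UNIV"
      using f(2) by (simp add: Lspace_def V_integrable_def abs_of_pos[OF f(1)])
    show "convex_diff (\<Phi> x) (d\<Phi> x)" for x
    proof -
      have "convex_diff (\<lambda>u. \<bar>u x\<bar> powr (\<alpha> + 1) / (\<alpha> + 1)) (\<lambda>u v. \<bar>u x\<bar> powr (\<alpha> - 1) * (u x * v x))"
        using value_form.convex_diff_powr[of "\<alpha> + 1" x] exps by simp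
      then show ?thesis
        unfolding \<Phi>_def[abs_def] d\<Phi>_def[abs_def] P_eq
        using exps ab lg \<mu> by (intro convex_diff_scale convex_diff_add energy_convex_diff)
    qed
    show "0 \<le> \<Phi> x u" for x u
      unfolding \<Phi>_def P_eq by (rule mult_nonneg_nonneg[OF \<mu>]) (intro add_nonneg_nonneg term_nonneg)
    show "\<Phi> x (\<lambda>_. 0) = 0" for x
      by (simp add: \<Phi>_def P_def energy_zero)
    show "\<Phi> x v \<le> \<Phi> x u" if "\<And>y. \<bar>v y\<bar> \<le> \<bar>u y\<bar>" "\<And>y z. \<bar>v y - v z\<bar> \<le> \<bar>u y - u z\<bar>" for x u v
      unfolding \<Phi>_def P_eq using exps ab lg \<mu> that
      by (intro mult_left_mono add_mono energy_contraction divide_right_mono powr_mono2) auto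
    show "continuous_on UNIV (\<Phi> x)" for x
      unfolding \<Phi>_def[abs_def] P_def using exps
      by (intro continuous_intros energy_continuous continuous_on_powr') auto
    show "\<mu>0 * (a0 / p) * \<bar>u x\<bar> powr p \<le> \<Phi> x u" for x u
    proof -
      have "a0 / p * \<bar>u x\<bar> powr p \<le> a x / p * \<bar>u x\<bar> powr p"
        using a exps by (intro mult_right_mono divide_right_mono) auto
      also have "\<dots> \<le> energy a p x u" by (rule energy_coercive[OF exps(4)])
      also have "\<dots> \<le> P x u" using term_nonneg[of x u] by (simp add: P_eq)
      finally have "\<mu>0 * (a0 / p * \<bar>u x\<bar> powr p) \<le> \<mu> x * P x u"
        using \<mu>0 a exps \<mu> by (intro mult_mono) auto
      then show ?thesis by (simp only: mult.assoc \<Phi>_def)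
    qed
    show "(\<lambda>x. \<Phi> x (\<lambda>y. u y + t * v y)) summable_on UNIV"
      if "(\<lambda>x. \<Phi> x u) summable_on UNIV" "(\<lambda>x. \<Phi> x v) summable_on UNIV" for u v t
      using that W1_weighted_linear[of p a0 a, OF exps(4) a] W1_weighted_linear[of q b0 b, OF exps(3) b]
      unfolding in_W[symmetric] by (auto simp: W_def)
    show "(\<lambda>x. \<Phi> x (\<lambda>y. if y = z then 1 else 0)) summable_on UNIV" for z
      unfolding in_W[symmetric] W_def Int_iff W1_weighted_iff_energy[of p a0 a, OF exps(4) a] W1_weighted_iff_energy[of q b0 b, OF exps(3) b]
      by (intro conjI energy_delta_summable)
  qed
  obtain u where u: "u \<in> W" "\<And>x. 0 < u x"
    and F: "\<And>v. v \<in> W \<Longrightarrow> (\<lambda>x. \<mu> x * f x * u x powr (- \<gamma>) * v x) summable_on UNIV"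
    and eq: "\<And>v. v \<in> W \<Longrightarrow> (\<Sum>\<^sub>\<infinity>x. d\<Phi> x u v) = (\<Sum>\<^sub>\<infinity>x. \<mu> x * f x * u x powr (- \<gamma>) * v x)"
    by (rule sv.ex_singular_solution, unfold in_W[symmetric]) blast
  have "V_integrable \<mu> (weak_integrand E \<omega> \<mu> a p u v) \<and>
        V_integrable \<mu> (weak_integrand E \<omega> \<mu> b q u v) \<and>
        V_integrable \<mu> (\<lambda>x. f x * u x powr (- \<gamma>) * v x) \<and>
        V_integrable \<mu> (\<lambda>x. g x * u x powr \<alpha> * v x) \<and>
        V_integral \<mu> (weak_integrand E \<omega> \<mu> a p u v) + V_integral \<mu> (weak_integrand E \<omega> \<mu> b q u v) =
        V_integral \<mu> (\<lambda>x. f x * u x powr (- \<gamma>) * v x) + lam * V_integral \<mu> (\<lambda>x. g x * u x powr \<alpha> * v x)"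
    if v: "v \<in> W" for v
  proof -
    \<comment> \<open>A solution needs each integrand integrable by itself, whereas the abstract
      equation only has their sum. Finite energy of \<open>u\<close>, \<open>u + v\<close> and
      \<open>u - v\<close> gives this for each exponent separately.\<close>
    have weak: "(\<lambda>x. \<mu> x * weak_integrand E \<omega> \<mu> c s u v x) summable_on UNIV"
      if s: "1 < s" "0 < c0" "\<And>x. c0 \<le> c x"
        and uv: "u \<in> W1_weighted E \<omega> \<mu> c s" "v \<in> W1_weighted E \<omega> \<mu> c s" for c s c0
    proof -
      have "(\<lambda>x. \<mu> x * energy_deriv c s x u v) summable_on UNIV"
      proof (rule summable_convex_diff[where P = "\<lambda>x u. \<mu> x * energy c s x u"
            and d = "\<lambda>x u v. \<mu> x * energy_deriv c s x u v"])
        show "convex_diff (\<lambda>u. \<mu> x * energy c s x u) (\<lambda>u v. \<mu> x * energy_deriv c s x u v)" for x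
        proof -
          have "0 \<le> c x" using s(2) s(3)[of x] by linarith
          then show ?thesis
            using s(1) \<mu> by (intro convex_diff_scale energy_convex_diff)
        qed
        show "(\<lambda>x. \<mu> x * energy c s x u) summable_on UNIV"
          "(\<lambda>x. \<mu> x * energy c s x (\<lambda>y. u y + v y)) summable_on UNIV"
          "(\<lambda>x. \<mu> x * energy c s x (\<lambda>y. u y - v y)) summable_on UNIV"
          using uv(1) W1_weighted_linear[of s c0 c u v 1, OF s uv] W1_weighted_linear[of s c0 c u v "-1", OF s uv]
          unfolding W1_weighted_iff_energy[of s c0 c, OF s] by simp_all
      qed
      then show ?thesis using energy_deriv_pos[of u, OF u(2)] by simp
    qed
    have wa: "(\<lambda>x. \<mu> x * weak_integrand E \<omega> \<mu> a p u v x) summable_on UNIV"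
      using u v by (intro weak[of p a0 a, OF exps(4) a]) (auto simp: W_def)
    have wb: "(\<lambda>x. \<mu> x * weak_integrand E \<omega> \<mu> b q u v x) summable_on UNIV"
      using u v by (intro weak[of q b0 b, OF exps(3) b]) (auto simp: W_def)
    have "u \<in> W1_weighted E \<omega> \<mu> a p" "v \<in> W1_weighted E \<omega> \<mu> a p"
      using u v by (auto simp: W_def)
    then obtain M M' where M: "\<And>x. \<bar>u x\<bar> \<le> M" and M': "1 \<le> M'" "\<And>x. \<bar>v x\<bar> \<le> M'"
      by (metis W1_weighted_bounded[of p a0 a \<mu>0, OF exps(4) a \<mu>0])
    have bound: "\<bar>u x powr \<alpha> * v x\<bar> \<le> M powr \<alpha> * M'" for x
      unfolding abs_mult using M[of x] M'(1) M'(2)[of x] u(2)[of x] exps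
      by (intro mult_mono) (auto intro: powr_mono2)
    have wg: "(\<lambda>x. \<mu> x * (g x * u x powr \<alpha> * v x)) summable_on UNIV"
      using g_summable[of "\<lambda>x. u x powr \<alpha> * v x", OF bound] by (simp add: mult.assoc)
    have "d\<Phi> x u v = \<mu> x * weak_integrand E \<omega> \<mu> a p u v x + \<mu> x * weak_integrand E \<omega> \<mu> b q u v x
        - lam * (\<mu> x * (g x * u x powr \<alpha> * v x))" for x
    proof -
      have pw: "\<bar>u x\<bar> powr (\<alpha> - 1) * (u x * v x) = u x powr \<alpha> * v x"
        using u(2)[of x] by (simp add: powr_diff)
      show ?thesis
        unfolding d\<Phi>_def energy_deriv_pos[of u, OF u(2)] pw by (simp add: algebra_simps)
    qed
    then have "(\<Sum>\<^sub>\<infinity>x. d\<Phi> x u v) = (\<Sum>\<^sub>\<infinity>x. \<mu> x * weak_integrand E \<omega> \<mu> a p u v x)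
        + (\<Sum>\<^sub>\<infinity>x. \<mu> x * weak_integrand E \<omega> \<mu> b q u v x) - lam * (\<Sum>\<^sub>\<infinity>x. \<mu> x * (g x * u x powr \<alpha> * v x))"
      using wa wb wg
      by (simp add: infsum_diff_real infsum_add summable_on_add summable_on_cmult_right infsum_cmult_right')
    then show ?thesis
      using eq[OF v] wa wb wg F[OF v] by (simp add: V_integrable_def V_integral_def mult.assoc)
  qed
  then have "positive_solution E \<omega> \<mu> p q \<gamma> \<alpha> lam a b f g u"
    using u by (simp add: positive_solution_def Let_def W_def[symmetric])
  then show ?thesis by blast
qed

end

theorem theorem1p2:
  fixes E :: "('v \<times> 'v) set"
    and \<omega> :: "'v \<Rightarrow> 'v \<Rightarrow> real"
    and \<mu> f g a b :: "'v \<Rightarrow> real"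
    and \<mu>\<^sub>0 C a\<^sub>0 b\<^sub>0 p q \<gamma> \<alpha> lam :: real
  assumes "weighted_graph E \<omega> \<mu>"
    and "\<mu>\<^sub>0 > 0" and "\<And>x. \<mu> x \<ge> \<mu>\<^sub>0"
    and "C > 0" and "\<And>x. (\<Sum>y\<in>E `` {x}. \<omega> x y) < C"
    and "0 < \<gamma>" and "\<gamma> < 1" and "1 < q" and "q \<le> p" and "p < \<alpha> + 1"
    and "\<And>x. f x > 0"
    and "\<And>x. g x \<ge> 0" and "\<exists>x. g x \<noteq> 0"
    and "f \<in> Lspace \<mu> 1 \<inter> Lspace \<mu> (p / (p - 1 + \<gamma>)) \<inter> Lspace \<mu> (q / (q - 1 + \<gamma>))"
    and "g \<in> Lspace \<mu> 1 \<inter> Linfty"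
    and "a\<^sub>0 > 0" and "\<And>x. a x \<ge> a\<^sub>0"
    and "b\<^sub>0 > 0" and "\<And>x. b x \<ge> b\<^sub>0"
    and "lam < 0"
  shows "\<exists>!u. positive_solution E \<omega> \<mu> p q \<gamma> \<alpha> lam a b f g u"
proof -
  interpret weighted_graph E \<omega> \<mu> by fact
  show ?thesis
  proof (rule ex_ex1I)
    show "\<exists>u. positive_solution E \<omega> \<mu> p q \<gamma> \<alpha> lam a b f g u"
      using assms by (intro ex_positive_solution[of \<mu>\<^sub>0 \<gamma> q p \<alpha> lam f g a\<^sub>0 a b\<^sub>0 b]) auto
    show "u = v" if "positive_solution E \<omega> \<mu> p q \<gamma> \<alpha> lam a b f g u"
      "positive_solution E \<omega> \<mu> p q \<gamma> \<alpha> lam a b f g v" for u v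
      using assms that
      by (intro positive_solution_unique[of \<gamma> q p \<alpha> lam f g a\<^sub>0 a b\<^sub>0 b u v]) auto
  qed
qed

end
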